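(* Let $\Bbbk$ be a field of characteristic zero and let $p_1(x),p_2(x)\in\Bbbk[x]$ be two polynomials of positive degree. Then $K\{p_1(x)xy\}\cong K\{p_2(x)xy\}$ as Poisson fields if and only if there are $a\in\Bbbk^\times$ and $b\in\Bbbk$ such that $$a^{-1}(ax-b)\,p_1(ax-b)=\pm\, x\,p_2(x)$$ (for some choice of sign). In this case, $\deg p_1=\deg p_2$.
   Context: For $\mathbf f\in\Bbbk(x,y)$, $K\{\mathbf f\}$ denotes the rational function field $\Bbbk(x,y)$ equipped with the unique ($\Bbbk$-bilinear) Poisson bracket such that $\{x,y\}=\mathbf f$; explicitly $\{g,h\}=\left(\frac{\partial g}{\partial x}\frac{\partial h}{\partial y}-\frac{\partial g}{\partial y}\frac{\partial h}{\partial x}\right)\mathbf f$. Isomorphisms of Poisson fields are $\Bbbk$-algebra isomorphisms preserving the Poisson brackets. *)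

theory Defs
  imports
    "HOL-Computational_Algebra.Polynomial"
    "HOL-Computational_Algebra.Fraction_Field"
begin

(* The rational function field in two variables is the fraction field of k[x][y]:
   the coefficients of the outer polynomial (in y) are polynomials in x. *)
type_synonym 'a ratfun2 = "'a poly poly fract"

definition rf_const :: "'a::field_char_0 \<Rightarrow> 'a ratfun2" where
  "rf_const c = Fract [:[:c:]:] 1"

definition rf_of_poly_x :: "'a::field_char_0 poly \<Rightarrow> 'a ratfun2" where
  "rf_of_poly_x p = Fract [:p:] 1"

definition rf_X :: "'a::field_char_0 ratfun2" where
  "rf_X = rf_of_poly_x [:0, 1:]"

definition rf_Y :: "'a::field_char_0 ratfun2" where
  "rf_Y = Fract [:0, 1:] 1"

lemma map_poly_pderiv_add:
  "map_poly pderiv (p + q) = map_poly pderiv p + map_poly pderiv (q :: 'a::idom poly poly)"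
  by (rule poly_eqI) (simp add: coeff_map_poly pderiv_add)

lemma map_poly_pderiv_smult:
  "map_poly pderiv (smult a q) =
     smult (pderiv a) q + smult a (map_poly pderiv (q :: 'a::idom poly poly))"
  by (rule poly_eqI) (simp add: coeff_map_poly pderiv_mult algebra_simps)

lemma map_poly_pderiv_mult:
  "map_poly pderiv (p * q) =
     map_poly pderiv p * q + p * map_poly pderiv (q :: 'a::idom poly poly)"
proof (induction p)
  case 0
  then show ?case by simp
next
  case (pCons a p)
  have "map_poly pderiv (pCons a p * q) =
      map_poly pderiv (smult a q) + map_poly pderiv (pCons 0 (p * q))"
    by (simp add: mult_pCons_left map_poly_pderiv_add)
  also have "\<dots> = map_poly pderiv (pCons a p) * q + pCons a p * map_poly pderiv q"
    by (simp add: map_poly_pderiv_smult map_poly_pCons pCons.IH mult_pCons_left algebra_simps)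
  finally show ?case .
qed

lemma quotient_rule_respects:
  fixes D :: "'b::idom \<Rightarrow> 'b"
  assumes D: "\<And>u v. D (u * v) = D u * v + u * D v"
    and eq: "a * d = c * b"
  shows "(D a * b - a * D b) * (d * d) = (D c * d - c * D d) * (b * b)"
proof -
  have 1: "D a * d + a * D d = D c * b + c * D b"
    using D[of a d] D[of c b] eq by simp
  have "(D a * b - a * D b) * (d * d) = (D a * d) * (b * d) - (a * d) * (d * D b)"
    by (simp add: algebra_simps)
  also have "D a * d = D c * b + c * D b - a * D d"
    using 1 by (simp add: algebra_simps)
  also have "(D c * b + c * D b - a * D d) * (b * d) - (a * d) * (d * D b) =
      D c * b * b * d + c * b * d * D b - (a * d) * (b * D d) - (a * d) * (d * D b)"
    by (simp add: algebra_simps)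
  also have "\<dots> = (D c * d - c * D d) * (b * b)"
    unfolding eq by (simp add: algebra_simps)
  finally show ?thesis .
qed

lemma Fract_quotient_rule_cong:
  fixes D :: "'b::idom \<Rightarrow> 'b"
  assumes "\<And>u v. D (u * v) = D u * v + u * D v"
    and "b \<noteq> 0" "d \<noteq> 0" "Fract a b = Fract c d"
  shows "Fract (D a * b - a * D b) (b * b) = Fract (D c * d - c * D d) (d * d)"
  using quotient_rule_respects[OF assms(1), of a d c b] assms(2-4)
  by (simp add: eq_fract)

(* Extension of a derivation of an integral domain to its fraction field by the quotient rule;
   the description is proper whenever D satisfies the Leibniz rule, see fract_deriv_Fract. *)
definition fract_deriv :: "('b::idom \<Rightarrow> 'b) \<Rightarrow> 'b fract \<Rightarrow> 'b fract" where
  "fract_deriv D r =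
     (THE d. \<exists>u v. v \<noteq> 0 \<and> r = Fract u v \<and> d = Fract (D u * v - u * D v) (v * v))"

lemma fract_deriv_Fract:
  fixes D :: "'b::idom \<Rightarrow> 'b"
  assumes "\<And>u v. D (u * v) = D u * v + u * D v" and "v \<noteq> 0"
  shows "fract_deriv D (Fract u v) = Fract (D u * v - u * D v) (v * v)"
  unfolding fract_deriv_def
proof (rule the_equality)
  show "\<exists>u' v'. v' \<noteq> 0 \<and> Fract u v = Fract u' v' \<and>
      Fract (D u * v - u * D v) (v * v) = Fract (D u' * v' - u' * D v') (v' * v')"
    using assms(2) by blast
next
  fix d
  assume "\<exists>u' v'. v' \<noteq> 0 \<and> Fract u v = Fract u' v' \<and> d = Fract (D u' * v' - u' * D v') (v' * v')"
  then show "d = Fract (D u * v - u * D v) (v * v)"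
    using Fract_quotient_rule_cong[of D, OF assms(1)] assms(2) by metis
qed

definition rf_dx :: "'a::field_char_0 ratfun2 \<Rightarrow> 'a ratfun2" where
  "rf_dx = fract_deriv (map_poly pderiv)"

definition rf_dy :: "'a::field_char_0 ratfun2 \<Rightarrow> 'a ratfun2" where
  "rf_dy = fract_deriv pderiv"

lemma rf_dx_Fract:
  "v \<noteq> 0 \<Longrightarrow> rf_dx (Fract u v) = Fract (map_poly pderiv u * v - u * map_poly pderiv v) (v * v)"
  unfolding rf_dx_def by (rule fract_deriv_Fract) (rule map_poly_pderiv_mult)

lemma rf_dy_Fract:
  "v \<noteq> 0 \<Longrightarrow> rf_dy (Fract u v) = Fract (pderiv u * v - u * pderiv v) (v * v)"
  unfolding rf_dy_def by (rule fract_deriv_Fract) (simp_all add: pderiv_mult algebra_simps)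

(* The bracket of K{f}, the unique k-bilinear Poisson bracket with {x, y} = f. The field
   underlying K{f} does not depend on f, so f alone represents K{f} in poisson_iso. *)
definition rf_bracket ::
  "'a::field_char_0 ratfun2 \<Rightarrow> 'a ratfun2 \<Rightarrow> 'a ratfun2 \<Rightarrow> 'a ratfun2" where
  "rf_bracket f g h = (rf_dx g * rf_dy h - rf_dy g * rf_dx h) * f"

lemma rf_bracket_X_Y: "rf_bracket f rf_X rf_Y = f"
  by (simp add: rf_bracket_def rf_X_def rf_Y_def rf_of_poly_x_def rf_dx_Fract rf_dy_Fract
      map_poly_pCons pderiv_pCons map_poly_1 Zero_fract_def[symmetric] One_fract_def[symmetric]
      one_pCons[symmetric])

definition poisson_iso ::
  "'a::field_char_0 ratfun2 \<Rightarrow> 'a ratfun2 \<Rightarrow> ('a ratfun2 \<Rightarrow> 'a ratfun2) \<Rightarrow> bool" where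
  "poisson_iso f1 f2 \<phi> \<longleftrightarrow>
     bij \<phi> \<and>
     (\<forall>g h. \<phi> (g + h) = \<phi> g + \<phi> h) \<and>
     (\<forall>g h. \<phi> (g * h) = \<phi> g * \<phi> h) \<and>
     (\<forall>c. \<phi> (rf_const c) = rf_const c) \<and>
     (\<forall>g h. \<phi> (rf_bracket f1 g h) = rf_bracket f2 (\<phi> g) (\<phi> h))"

definition poisson_isomorphic :: "'a::field_char_0 ratfun2 \<Rightarrow> 'a ratfun2 \<Rightarrow> bool" where
  "poisson_isomorphic f1 f2 \<longleftrightarrow> (\<exists>\<phi>. poisson_iso f1 f2 \<phi>)"

end

theory Submission
  imports Defs "HOL-Computational_Algebra.Formal_Laurent_Series"
    "HOL-Computational_Algebra.Polynomial_Factorial"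
begin

unbundle fps_syntax

text \<open>
  Write $P_i = x p_i$, so that $\deg P_i \ge 2$, and embed $k(x,y)$ into $k(x)((y))$. The bracket with
  $\{x,y\} = P_1 y$ satisfies $\nu\{f,g\} \ge \nu f + \nu g$ for the $y$-adic valuation $\nu$.
  An isomorphism yields generators $\xi, \eta$ of $k(x,y)$ with $\{\xi,\eta\} = P_2(\xi)\eta$;
  since $\deg P_2 \ge 2$, $\xi$ has no pole, so it has a residue $r \in k(x)$.

  If $r$ is not constant, leading coefficients give $t r' P_1 = P_2(r)$, where $t = \nu(\eta) = \pm 1$
  because $\nu$ takes the value $1$ on $k(\xi,\eta)$. Likewise $x \in k(r)$, so $r$ is unramified
  at $x = \infty$; for $\deg P_1 \ge 3$ this forces $\deg P_1 = \deg P_2$ and then $r$ has no finite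
  pole, so that $r$ is affine.

  If $r = \alpha$ is constant, let $m$ be the order of $P_2$ at $\alpha$ and $\zeta = \xi - \alpha$. The
  operator $\zeta^{m-1}\eta\,\partial_\eta$ on $k(\xi,\eta)$ does not lower $\nu$ and maps $x$ to a
  nonzero constant multiple of $P_1(x)$ modulo positive valuation. Its flow turns this into a rational
  solution $R(T)$ of $(1 + \varepsilon T) R' = c P_1(R)$, which is impossible for $\deg P_1 \ge 3$.

  If both degrees are $2$, say $P_i = x(e_i + c_i x)$ with $e_2 \ne 0$, then
  $h = \xi/(\xi + e_2/c_2)$ satisfies $\{h,\eta\} = e_2 h \eta$. Leading coefficients in $y$ and then at
  $x = 0$ show that $e_2$ is an integer multiple of $e_1$; by symmetry $e_1 = \pm e_2$.
\<close>

section \<open>Homomorphisms and derivations\<close>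

definition is_hom :: "('a::comm_ring_1 \<Rightarrow> 'b::comm_ring_1) \<Rightarrow> bool" where
  "is_hom h \<longleftrightarrow> h 1 = 1 \<and> (\<forall>a b. h (a + b) = h a + h b) \<and> (\<forall>a b. h (a * b) = h a * h b)"

lemma is_homI:
  assumes "h 1 = 1" "\<And>a b. h (a + b) = h a + h b" "\<And>a b. h (a * b) = h a * h b"
  shows "is_hom h"
  using assms by (auto simp: is_hom_def)

lemma
  assumes "is_hom h"
  shows hom_1: "h 1 = 1"
    and hom_add: "h (a + b) = h a + h b"
    and hom_mult: "h (a * b) = h a * h b"
    and hom_0: "h 0 = 0"
    and hom_minus: "h (- a) = - h a"
    and hom_diff: "h (a - b) = h a - h b"
proof -
  show 1: "h 1 = 1" "\<And>a b. h (a + b) = h a + h b" "h (a * b) = h a * h b"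
    using assms by (auto simp: is_hom_def)
  show 0: "h 0 = 0" using 1(2)[of 0 0] by simp
  have m: "\<And>a. h (- a) = - h a" using 1(2)[of a "-a" for a] 0 by (simp add: eq_neg_iff_add_eq_0 add.commute)
  show "h (- a) = - h a" by (rule m)
  show "h (a - b) = h a - h b" using 1(2)[of a "-b"] m by simp
qed

lemma hom_power: "is_hom h \<Longrightarrow> h (a ^ n) = h a ^ n"
  by (induction n) (simp_all add: hom_1 hom_mult)

lemma hom_sum: "is_hom h \<Longrightarrow> h (sum f A) = (\<Sum>i\<in>A. h (f i))"
  by (induction A rule: infinite_finite_induct) (simp_all add: hom_0 hom_add)

lemma hom_of_nat: "is_hom h \<Longrightarrow> h (of_nat n) = of_nat n"
  by (induction n) (simp_all add: hom_0 hom_1 hom_add)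

lemma hom_of_int: "is_hom h \<Longrightarrow> h (of_int n) = of_int n"
  by (cases n) (simp_all add: hom_minus hom_1 hom_of_nat hom_diff)

lemma hom_comp: "is_hom g \<Longrightarrow> is_hom h \<Longrightarrow> is_hom (\<lambda>x. g (h x))"
  by (simp add: is_hom_def)

lemma hom_eq_0_iff:
  fixes h :: "'a::field \<Rightarrow> 'b::comm_ring_1"
  assumes "is_hom h" "(0::'b) \<noteq> 1"
  shows "h a = 0 \<longleftrightarrow> a = 0"
proof
  assume "h a = 0"
  then have "a \<noteq> 0 \<Longrightarrow> h (a * inverse a) = 0" by (simp only: hom_mult[OF assms(1)] mult_zero_left)
  then show "a = 0" using assms hom_1[OF assms(1)] by (cases "a = 0") auto
qed (simp add: hom_0 assms)

lemma hom_inverse: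
  fixes h :: "'a::field \<Rightarrow> 'b::field"
  assumes "is_hom h"
  shows "h (inverse a) = inverse (h a)"
proof (cases "a = 0")
  case False
  then have "h a * h (inverse a) = 1" using assms by (simp flip: hom_mult add: hom_1)
  then show ?thesis by (simp add: inverse_unique)
qed (simp add: hom_0 assms)

lemma hom_to_fract: "is_hom (to_fract :: 'a::idom \<Rightarrow> 'a fract)"
  by (intro is_homI) simp_all

lemma hom_const_poly: "is_hom (\<lambda>c::'a::comm_ring_1. [:c:])"
  by (intro is_homI) (simp_all add: one_pCons)

lemma hom_fls_const: "is_hom (fls_const :: 'a::comm_ring_1 \<Rightarrow> 'a fls)"
  by (intro is_homI) (simp_all add: fls_plus_const)

lemma hom_map_poly:
  assumes h: "is_hom (h :: 'a::comm_ring_1 \<Rightarrow> 'b::comm_ring_1)"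
  shows "is_hom (map_poly h)"
proof (rule is_homI)
  show "map_poly h 1 = 1" using h by (simp add: map_poly_1 hom_1)
  show "map_poly h (a + b) = map_poly h a + map_poly h b" for a b
    by (rule poly_eqI) (simp add: coeff_map_poly hom_0[OF h] hom_add[OF h])
  show "map_poly h (a * b) = map_poly h a * map_poly h b" for a b
    by (rule poly_eqI) (simp add: coeff_map_poly hom_0[OF h] coeff_mult hom_sum[OF h] hom_mult[OF h])
qed

text \<open>Evaluation with the coefficients moved along \<open>h\<close>. Nesting it, as in
  \<open>hom_eval (hom_eval cst \<xi>) \<eta>\<close>, evaluates polynomials in two
  variables.\<close>

definition hom_eval :: "('a::comm_ring_1 \<Rightarrow> 'b::comm_ring_1) \<Rightarrow> 'b \<Rightarrow> 'a poly \<Rightarrow> 'b" where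
  "hom_eval h x p = poly (map_poly h p) x"

lemma hom_hom_eval: "is_hom h \<Longrightarrow> is_hom (hom_eval h x)"
  unfolding is_hom_def[of "hom_eval h x"] hom_eval_def
  by (simp add: hom_1 hom_add hom_mult hom_map_poly)

lemma hom_eval_0 [simp]: "hom_eval h x 0 = 0"
  by (simp add: hom_eval_def)

lemma hom_eval_pCons: "is_hom h \<Longrightarrow> hom_eval h x (pCons a p) = h a + x * hom_eval h x p"
  by (simp add: hom_eval_def map_poly_pCons hom_0)

lemma hom_hom_eval_commute:
  assumes "is_hom g" "is_hom h"
  shows "g (hom_eval h x p) = hom_eval (\<lambda>a. g (h a)) (g x) p"
  by (induction p) (simp_all add: hom_eval_pCons hom_comp assms hom_0[OF assms(1)] hom_add[OF assms(1)] hom_mult[OF assms(1)])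

section \<open>Extending injective homomorphisms to fraction fields\<close>

definition fract_lift :: "('d::idom \<Rightarrow> 'f::field) \<Rightarrow> 'd fract \<Rightarrow> 'f" where
  "fract_lift h q = (THE d. \<exists>u v. v \<noteq> 0 \<and> q = Fract u v \<and> d = h u / h v)"

context
  fixes h :: "'d::idom \<Rightarrow> 'f::field"
  assumes h: "is_hom h" and inj: "\<And>u. u \<noteq> 0 \<Longrightarrow> h u \<noteq> 0"
begin

lemma fract_lift_Fract:
  assumes "v \<noteq> 0"
  shows "fract_lift h (Fract u v) = h u / h v"
  unfolding fract_lift_def
proof (rule the_equality)
  fix d assume "\<exists>u' v'. v' \<noteq> 0 \<and> Fract u v = Fract u' v' \<and> d = h u' / h v'"
  then obtain u' v' where v': "v' \<noteq> 0" "Fract u v = Fract u' v'" "d = h u' / h v'" by blast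
  then have "u * v' = u' * v" using assms by (simp add: eq_fract)
  then have "h u * h v' = h u' * h v" by (metis hom_mult[OF h])
  moreover have "h v \<noteq> 0" "h v' \<noteq> 0" using v'(1) assms inj by auto
  ultimately show "d = h u / h v" unfolding v'(3) by (simp add: frac_eq_eq)
qed (use assms in blast)

lemma fract_lift_to_fract: "fract_lift h (to_fract u) = h u"
  by (simp add: to_fract_def fract_lift_Fract hom_1[OF h])

lemma hom_fract_lift: "is_hom (fract_lift h)"
proof (rule is_homI)
  show "fract_lift h 1 = 1" by (simp add: One_fract_def fract_lift_Fract hom_1[OF h])
  fix a b :: "'d fract"
  obtain u v u' v' where "a = Fract u v" "v \<noteq> 0" "b = Fract u' v'" "v' \<noteq> 0"
    by (metis Fract_cases)
  then show "fract_lift h (a + b) = fract_lift h a + fract_lift h b"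
    and "fract_lift h (a * b) = fract_lift h a * fract_lift h b"
    using inj by (simp_all add: fract_lift_Fract hom_add[OF h] hom_mult[OF h] field_simps)
qed

end

section \<open>Derivations and their extension to fractions\<close>

definition is_deriv :: "('a::comm_ring_1 \<Rightarrow> 'a) \<Rightarrow> bool" where
  "is_deriv D \<longleftrightarrow> (\<forall>a b. D (a + b) = D a + D b) \<and> (\<forall>a b. D (a * b) = D a * b + a * D b)"

lemma is_derivI:
  assumes "\<And>a b. D (a + b) = D a + D b" "\<And>a b. D (a * b) = D a * b + a * D b"
  shows "is_deriv D"
  using assms by (auto simp: is_deriv_def)

lemma
  assumes "is_deriv D"
  shows deriv_add: "D (a + b) = D a + D b"
    and deriv_mult: "D (a * b) = D a * b + a * D b"
    and deriv_0: "D 0 = 0"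
    and deriv_1: "D 1 = 0"
    and deriv_diff: "D (a - b) = D a - D b"
proof -
  show 1: "\<And>a b. D (a + b) = D a + D b" and 2: "\<And>a b. D (a * b) = D a * b + a * D b"
    using assms by (auto simp: is_deriv_def)
  show "D 0 = 0" using 1[of 0 0] by simp
  show "D 1 = 0" using 2[of 1 1] by simp
  show "D (a - b) = D a - D b" using 1[of "a - b" b] by simp
qed

lemma is_deriv_pderiv: "is_deriv (pderiv :: 'a::idom poly \<Rightarrow> 'a poly)"
  by (rule is_derivI) (simp_all add: pderiv_add pderiv_mult algebra_simps)

lemma is_deriv_map_poly_pderiv: "is_deriv (map_poly pderiv :: 'a::idom poly poly \<Rightarrow> _)"
  by (rule is_derivI) (simp_all add: map_poly_pderiv_add map_poly_pderiv_mult)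

lemma is_deriv_fls_deriv: "is_deriv (fls_deriv :: 'a::comm_ring_1 fls \<Rightarrow> _)"
  by (rule is_derivI) (simp_all add: algebra_simps)

lemma
  assumes D: "is_deriv D"
  shows is_deriv_fract_deriv: "is_deriv (fract_deriv D)"
    and fract_deriv_to_fract: "fract_deriv D (to_fract a) = to_fract (D a)"
proof -
  note L = deriv_mult[OF D]
  show "is_deriv (fract_deriv D)"
  proof (rule is_derivI)
    fix a b :: "'a fract"
    obtain u v u' v' where *: "a = Fract u v" "v \<noteq> 0" "b = Fract u' v'" "v' \<noteq> 0"
      by (metis Fract_cases)
    then have "v * v' \<noteq> 0" by simp
    note s = fract_deriv_Fract[of D, OF L]
    show "fract_deriv D (a + b) = fract_deriv D a + fract_deriv D b"
      unfolding *(1,3) add_fract[OF *(2,4)] s[OF *(2)] s[OF *(4)] s[OF \<open>v * v' \<noteq> 0\<close>]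
      using *(2,4) by (simp add: eq_fract L deriv_add[OF D] algebra_simps)
    show "fract_deriv D (a * b) = fract_deriv D a * b + a * fract_deriv D b"
      unfolding *(1,3) mult_fract s[OF *(2)] s[OF *(4)] s[OF \<open>v * v' \<noteq> 0\<close>]
      using *(2,4) by (simp add: eq_fract L deriv_add[OF D] algebra_simps)
  qed
  show "fract_deriv D (to_fract a) = to_fract (D a)"
    using deriv_1[OF D] by (simp add: to_fract_def fract_deriv_Fract[of D, OF L])
qed

text \<open>As functions of q, both sides are derivations along \<open>h\<close>, so agreement on
  the subring passes to quotients: differentiate u = q v and cancel h(v). The factor
  \<open>c\<close> allows for a change of variable, as in \<open>expand_ddx\<close>.\<close>

lemma fract_deriv_transport:
  fixes h :: "'d::idom fract \<Rightarrow> 'f::field"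
  assumes h: "is_hom h" and D: "is_deriv D" and E: "is_deriv E"
    and eq: "\<And>a. E (h (to_fract a)) = c * h (to_fract (D a))"
  shows "E (h q) = c * h (fract_deriv D q)"
proof -
  obtain u v where q: "q = Fract u v" "v \<noteq> 0" by (cases q)
  have uv: "to_fract u = q * to_fract v" using q by (simp add: to_fract_def eq_fract)
  have "fract_deriv D q * to_fract v + q * to_fract (D v) = to_fract (D u)"
    using arg_cong[OF uv, of "fract_deriv D"]
    by (simp add: deriv_mult[OF is_deriv_fract_deriv[OF D]] fract_deriv_to_fract[OF D])
  from arg_cong[OF this, of h]
  have 1: "h (fract_deriv D q) * h (to_fract v) + h q * h (to_fract (D v)) = h (to_fract (D u))"
    by (simp only: hom_mult[OF h] hom_add[OF h])
  have "E (h q) * h (to_fract v) + h q * (c * h (to_fract (D v))) = c * h (to_fract (D u))"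
    using arg_cong[OF uv, of "\<lambda>x. E (h x)"] by (simp only: hom_mult[OF h] deriv_mult[OF E] eq)
  also have "\<dots> = c * h (fract_deriv D q) * h (to_fract v) + h q * (c * h (to_fract (D v)))"
    unfolding 1[symmetric] by (simp add: algebra_simps)
  finally have "E (h q) * h (to_fract v) = c * h (fract_deriv D q) * h (to_fract v)" by simp
  moreover have "h (to_fract v) \<noteq> 0" using q hom_eq_0_iff[OF h] by simp
  ultimately show ?thesis by simp
qed

section \<open>The equation $E R' = P(R)$ for rational functions\<close>

text \<open>Euclid's algorithm with the cofactors carried along, so that coprimality of the reduced
  parts comes as an explicit identity.\<close>

lemma poly_bezout:
  fixes F G :: "'b::field poly"
  assumes "F \<noteq> 0 \<or> G \<noteq> 0"
  shows "\<exists>g F1 G1 a b. g \<noteq> 0 \<and> F = g * F1 \<and> G = g * G1 \<and> a * F1 + b * G1 = 1"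
  using assms
\<comment> \<open>The measure places G = 0 strictly below the nonzero constants, whose remainders
  vanish.\<close>
proof (induction "if G = 0 then 0 else Suc (degree G)" arbitrary: F G rule: less_induct)
  case less
  show ?case
  proof (cases "G = 0")
    case True
    then have "F \<noteq> 0 \<and> F = F * 1 \<and> G = F * 0 \<and> 1 * 1 + 0 * 0 = (1 :: 'b poly)" using less by simp
    then show ?thesis by blast
  next
    case False
    have "\<exists>g F1 G1 a b. g \<noteq> 0 \<and> G = g * F1 \<and> F mod G = g * G1 \<and> a * F1 + b * G1 = 1"
      using False degree_mod_less[of G F] by (intro less.hyps) auto
    then obtain g F1 G1 a b where *: "g \<noteq> 0" "G = g * F1" "F mod G = g * G1" "a * F1 + b * G1 = 1"
      by blast
    have "F = (F div G) * G + F mod G" by simp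
    also have "\<dots> = g * ((F div G) * F1 + G1)" unfolding *(3) by (subst (2) *(2)) (simp add: algebra_simps)
    finally have "F = g * ((F div G) * F1 + G1)" .
    moreover have "b * ((F div G) * F1 + G1) + (a - b * (F div G)) * F1 = 1"
      using *(4) by (simp add: algebra_simps)
    ultimately show ?thesis using * by blast
  qed
qed

text \<open>The argument of the rational root theorem: every term but the last contains a factor B,
  so B divides A^d; being coprime to A, it is a unit.\<close>

lemma unit_of_dvd_form:
  fixes A B :: "'b::field poly"
  assumes bez: "a * A + b * B = 1" and "h d \<noteq> 0"
    and dvd: "B dvd (\<Sum>i\<le>d. smult (h i) (A ^ i * B ^ (d - i)))"
  shows "B dvd 1"
proof -
  have "B dvd (\<Sum>i<d. smult (h i) (A ^ i * B ^ (d - i)))"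
    by (rule dvd_sum) (auto intro!: dvd_smult dvd_mult dvd_power)
  with dvd have "B dvd smult (h d) (A ^ d)"
    by (simp add: lessThan_Suc_atMost[symmetric] dvd_add_right_iff)
  then have 1: "B dvd A ^ d" using assms(2) by (simp add: dvd_smult_iff)
  \<comment> \<open>The Bezout identity says that a A is 1 modulo B, hence so are its
    powers.\<close>
  have 2: "B dvd (a * A) ^ n - 1" for n
  proof (induction n)
    case (Suc n)
    have "(a * A) ^ Suc n - 1 = (a * A) * ((a * A) ^ n - 1) + (a * A - 1)"
      by (simp add: algebra_simps)
    moreover have "a * A - 1 = - b * B" using bez by (simp add: algebra_simps eq_diff_eq)
    ultimately show ?case using Suc by simp
  qed simp
  have "B dvd (a * A) ^ d" using 1 by (simp add: power_mult_distrib)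
  then show ?thesis using 2[of d] using dvd_diff[of B "(a * A) ^ d" "(a * A) ^ d - 1"] by simp
qed

text \<open>With R = F/G the equation is E R' = h(R) multiplied by G^d, where h has degree d. In
  lowest terms the denominator divides the left side because d \<ge> 3, so it is constant by
  \<open>unit_of_dvd_form\<close>. For a nonconstant polynomial R the right side has degree d deg R,
  the left side at most deg R. Hence R is a constant, and then a root of h.\<close>

lemma no_rational_solution:
  fixes F G E :: "'b::field poly"
  assumes G: "G \<noteq> 0" and E: "degree E \<le> 1" and d: "d \<ge> 3" and hd: "h d \<noteq> 0"
    and eq: "E * (pderiv F * G - F * pderiv G) * G ^ (d - 2) =
      (\<Sum>i\<le>d. smult (h i) (F ^ i * G ^ (d - i)))"
  shows "\<exists>c. F = smult c G \<and> (\<Sum>i\<le>d. h i * c ^ i) = 0"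
proof -
  obtain g F1 G1 a b where g: "g \<noteq> 0" "F = g * F1" "G = g * G1" and bez: "a * F1 + b * G1 = 1"
    using poly_bezout[of F G] G by blast
  \<comment> \<open>The terms with g' cancel in F' G - F G', so the common factor contributes g^2
    there and g^d to each side.\<close>
  have "g ^ d * (E * (pderiv F1 * G1 - F1 * pderiv G1) * G1 ^ (d - 2)) =
      E * (pderiv F * G - F * pderiv G) * G ^ (d - 2)"
  proof -
    have "2 + (d - 2) = d" using d by simp
    then have "g ^ d = g ^ 2 * g ^ (d - 2)" by (metis power_add)
    then show ?thesis unfolding g(2,3)
      by (simp add: pderiv_mult power_mult_distrib power2_eq_square algebra_simps)
  qed
  also have "\<dots> = (\<Sum>i\<le>d. g ^ d * smult (h i) (F1 ^ i * G1 ^ (d - i)))"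
    unfolding eq
  proof (rule sum.cong[OF refl])
    fix i assume "i \<in> {..d}"
    then have "g ^ d = g ^ i * g ^ (d - i)" by (simp flip: power_add)
    then show "smult (h i) (F ^ i * G ^ (d - i)) = g ^ d * smult (h i) (F1 ^ i * G1 ^ (d - i))"
      unfolding g(2,3) by (simp add: power_mult_distrib algebra_simps)
  qed
  finally have eq1: "E * (pderiv F1 * G1 - F1 * pderiv G1) * G1 ^ (d - 2) =
      (\<Sum>i\<le>d. smult (h i) (F1 ^ i * G1 ^ (d - i)))"
    unfolding sum_distrib_left[symmetric] mult_cancel_left using g(1) by simp
  have "G1 dvd G1 ^ (d - 2)" using d by (intro dvd_power) simp
  then have "G1 dvd (\<Sum>i\<le>d. smult (h i) (F1 ^ i * G1 ^ (d - i)))"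
    unfolding eq1[symmetric] by simp
  then have "G1 dvd 1" by (rule unit_of_dvd_form[OF bez, where h = h, OF hd])
  then obtain c where c: "G1 = [:c:]" "c \<noteq> 0" by (metis is_unit_poly_iff dvd_0_left one_neq_zero)
  have eq2: "smult (c ^ (d - 1)) (E * pderiv F1) = (\<Sum>i\<le>d. smult (h i * c ^ (d - i)) (F1 ^ i))"
  proof -
    have "Suc (d - 2) = d - 1" using d by simp
    then have "c ^ (d - 1) = c * c ^ (d - 2)" by (metis power_Suc)
    then have "smult (c ^ (d - 1)) (E * pderiv F1) = E * (pderiv F1 * G1 - F1 * pderiv G1) * G1 ^ (d - 2)"
      unfolding c by (simp add: pderiv_pCons poly_const_pow mult.commute)
    also have "\<dots> = (\<Sum>i\<le>d. smult (h i * c ^ (d - i)) (F1 ^ i))"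
      unfolding eq1 by (rule sum.cong) (simp_all add: c poly_const_pow)
    finally show ?thesis .
  qed
  have "degree F1 = 0"
  proof (rule ccontr)
    assume *: "degree F1 \<noteq> 0"
    then have nz: "F1 \<noteq> 0" by auto
    define S where "S = (\<Sum>i<d. smult (h i * c ^ (d - i)) (F1 ^ i))"
    have "degree S < d * degree F1"
      unfolding S_def
    proof (rule degree_sum_less)
      fix i assume "i \<in> {..<d}"
      then have "i * degree F1 < d * degree F1" using * by simp
      then show "degree (smult (h i * c ^ (d - i)) (F1 ^ i)) < d * degree F1"
        by (metis degree_power_le degree_smult_le le_less_trans mult.commute order_trans)
    qed (use * d in simp)
    moreover have "degree (smult (h d) (F1 ^ d)) = d * degree F1"
      using hd degree_power_eq[OF nz, of d] by simp
    ultimately have "degree (S + smult (h d) (F1 ^ d)) = d * degree F1"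
      by (simp add: degree_add_eq_right)
    then have "degree (smult (c ^ (d - 1)) (E * pderiv F1)) = d * degree F1"
      unfolding eq2 S_def by (simp add: lessThan_Suc_atMost[symmetric])
    moreover have "degree (smult (c ^ (d - 1)) (E * pderiv F1)) \<le> degree E + degree (pderiv F1)"
      by (rule order_trans[OF degree_smult_le degree_mult_le])
    moreover have "degree (pderiv F1) \<le> degree F1 - 1"
      by (rule degree_le) (auto simp: coeff_pderiv coeff_eq_0)
    moreover have "degree F1 * 3 \<le> d * degree F1" using d by simp
    ultimately show False using E * by linarith
  qed
  then obtain f where f: "F1 = [:f:]" by (rule degree_eq_zeroE)
  have "[:\<Sum>i\<le>d. h i * c ^ (d - i) * f ^ i:] = 0"
  proof -
    have "[:\<Sum>i\<le>d. h i * c ^ (d - i) * f ^ i:] = (\<Sum>i\<le>d. smult (h i * c ^ (d - i)) (F1 ^ i))"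
      unfolding f by (simp add: poly_const_pow hom_sum[OF hom_const_poly])
    also have "\<dots> = 0" unfolding eq2[symmetric] by (simp add: f pderiv_pCons)
    finally show ?thesis .
  qed
  then have "0 = (\<Sum>i\<le>d. h i * c ^ (d - i) * f ^ i)" by simp
  also have "\<dots> = c ^ d * (\<Sum>i\<le>d. h i * (f / c) ^ i)"
    unfolding sum_distrib_left
  proof (rule sum.cong[OF refl])
    fix i assume "i \<in> {..d}"
    then have "c ^ d = c ^ (d - i) * c ^ i" by (simp flip: power_add)
    then show "h i * c ^ (d - i) * f ^ i = c ^ d * (h i * (f / c) ^ i)"
      using c(2) by (simp add: power_divide)
  qed
  finally have "(\<Sum>i\<le>d. h i * (f / c) ^ i) = 0" using c(2) by simp
  moreover have "F = smult (f / c) G" unfolding g(2,3) f c(1) using c(2) by simp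
  ultimately show ?thesis by blast
qed

section \<open>The valuation of Laurent series\<close>

text \<open>A bound on coefficients rather than on \<open>fls_subdegree\<close>, so that the zero
  series, whose \<open>fls_subdegree\<close> is 0, satisfies every bound.\<close>

definition vge :: "int \<Rightarrow> 'a::zero fls \<Rightarrow> bool" where
  "vge n f \<longleftrightarrow> (\<forall>k<n. f $$ k = 0)"

lemma vge_0 [simp]: "vge n 0"
  by (simp add: vge_def)

lemma vge_mono: "vge n f \<Longrightarrow> m \<le> n \<Longrightarrow> vge m f"
  by (simp add: vge_def)

lemma vge_add: "vge n f \<Longrightarrow> vge n g \<Longrightarrow> vge n (f + g :: 'a::monoid_add fls)"
  by (simp add: vge_def)

lemma vge_diff: "vge n f \<Longrightarrow> vge n g \<Longrightarrow> vge n (f - g :: 'a::group_add fls)"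
  by (simp add: vge_def)

lemma nth_sum: "(sum f A :: 'a::comm_monoid_add fls) $$ n = (\<Sum>i\<in>A. f i $$ n)"
  by (induction A rule: infinite_finite_induct) simp_all

lemma vge_sum: "(\<And>i. i \<in> A \<Longrightarrow> vge n (f i)) \<Longrightarrow> vge n (sum f A :: 'a::comm_monoid_add fls)"
  by (simp add: vge_def nth_sum)

lemma vge_subdegree: "vge (fls_subdegree f) f"
  by (simp add: vge_def)

lemma vge_fls_const: "vge 0 (fls_const c)"
  by (simp add: vge_def)

lemma vge_le_subdegree: "vge n f \<Longrightarrow> f \<noteq> 0 \<Longrightarrow> n \<le> fls_subdegree f"
  by (rule fls_subdegree_geI) (auto simp: vge_def)

lemma subdegree_eq_vge: "vge n f \<Longrightarrow> f $$ n \<noteq> 0 \<Longrightarrow> fls_subdegree f = n"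
  by (rule fls_subdegree_eqI) (auto simp: vge_def)

lemma nth_subdegree: "f \<noteq> 0 \<Longrightarrow> f $$ fls_subdegree f \<noteq> 0"
  by simp

text \<open>Arbitrary lower bounds are allowed: the coefficients at the bounds multiply even when
  they vanish and the exact valuations are unknown.\<close>

lemma
  fixes f g :: "'a::comm_ring_1 fls"
  assumes "vge m f" "vge n g"
  shows vge_mult: "vge (m + n) (f * g)"
    and nth_mult_vge: "(f * g) $$ (m + n) = f $$ m * g $$ n"
proof -
  have "vge (m + n) (f * g) \<and> (f * g) $$ (m + n) = f $$ m * g $$ n"
  proof (cases "f = 0 \<or> g = 0")
    case False
    then have *: "m \<le> fls_subdegree f" "n \<le> fls_subdegree g"
      using assms by (auto intro: vge_le_subdegree)
    then have "vge (m + n) (f * g)" by (auto simp: vge_def intro: fls_times_nth_eq0)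
    moreover have "(f * g) $$ (m + n) = f $$ m * g $$ n"
    proof (cases "m = fls_subdegree f \<and> n = fls_subdegree g")
      case True
      then show ?thesis by (simp add: fls_times_base)
    next
      case False
      then have "m < fls_subdegree f \<or> n < fls_subdegree g" using * by auto
      then have "f $$ m * g $$ n = 0" by auto
      moreover have "(f * g) $$ (m + n) = 0" using * False by (intro fls_times_nth_eq0) auto
      ultimately show ?thesis by simp
    qed
    ultimately show ?thesis by simp
  qed auto
  then show "vge (m + n) (f * g)" "(f * g) $$ (m + n) = f $$ m * g $$ n" by auto
qed

lemma vge_power: "vge m f \<Longrightarrow> vge (m * int i) (f ^ i :: 'a::comm_ring_1 fls)"
  and nth_power_vge: "vge m f \<Longrightarrow> (f ^ i) $$ (m * int i) = (f $$ m) ^ i"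
proof -
  assume f: "vge m f"
  have "vge (m * int i) (f ^ i) \<and> (f ^ i) $$ (m * int i) = (f $$ m) ^ i"
  proof (induction i)
    case 0
    then show ?case by (simp add: vge_def)
  next
    case (Suc i)
    then show ?case using vge_mult[OF f, of "m * int i" "f ^ i"] nth_mult_vge[OF f, of "m * int i" "f ^ i"]
      by (simp add: algebra_simps)
  qed
  then show "vge (m * int i) (f ^ i)" "(f ^ i) $$ (m * int i) = (f $$ m) ^ i" by auto
qed

lemma
  fixes f :: "'a::field fls"
  assumes "vge n f" "f $$ n \<noteq> 0"
  shows vge_inverse: "vge (- n) (inverse f)"
    and nth_inverse_vge: "inverse f $$ (- n) = inverse (f $$ n)"
proof -
  have s: "fls_subdegree f = n" using assms by (rule subdegree_eq_vge)
  have f: "f \<noteq> 0" using assms by auto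
  then have "fls_subdegree (inverse f) = - n"
    using fls_subdegree_mult[of f "inverse f"] s by simp
  then show v: "vge (- n) (inverse f)" using vge_subdegree[of "inverse f"] by simp
  have "(f * inverse f) $$ (n + - n) = f $$ n * inverse f $$ (- n)"
    by (rule nth_mult_vge[OF assms(1) v])
  moreover have "f * inverse f = 1" using f by simp
  ultimately have "f $$ n * inverse f $$ (- n) = 1" by simp
  then show "inverse f $$ (- n) = inverse (f $$ n)" by (rule inverse_unique[symmetric])
qed

text \<open>The range depends only on bounds, so in the product rule for
  \<open>fls_coeffwise\<close> one range serves all three products, although \<open>D\<close> may
  raise the valuation.\<close>

lemma nth_mult_conv:
  fixes f g :: "'a::comm_ring_1 fls"
  assumes "vge m f" "vge n g"
  shows "(f * g) $$ k = (\<Sum>i=m..k - n. f $$ i * g $$ (k - i))"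
proof (cases "f = 0 \<or> g = 0")
  case False
  then have *: "m \<le> fls_subdegree f" "n \<le> fls_subdegree g"
    using assms by (auto intro: vge_le_subdegree)
  have "(\<Sum>i=fls_subdegree f..k - fls_subdegree g. f $$ i * g $$ (k - i)) =
      (\<Sum>i=m..k - n. f $$ i * g $$ (k - i))"
    by (rule sum.mono_neutral_left) (use * in \<open>auto simp: not_le\<close>)
  then show ?thesis by (simp add: fls_times_nth(2))
qed auto

section \<open>Derivations acting on the coefficients of Laurent series\<close>

definition fls_coeffwise :: "('a::comm_ring_1 \<Rightarrow> 'a) \<Rightarrow> 'a fls \<Rightarrow> 'a fls" where
  "fls_coeffwise D f = Abs_fls (\<lambda>n. D (f $$ n))"

text \<open>The condition \<open>D 0 = 0\<close> keeps the family of coefficients bounded below, as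
  \<open>Abs_fls\<close> requires.\<close>

lemma fls_coeffwise_nth: "D 0 = 0 \<Longrightarrow> fls_coeffwise D f $$ n = D (f $$ n)"
  unfolding fls_coeffwise_def by (rule nth_Abs_fls_lower_bound[of "fls_subdegree f"]) simp

lemma is_deriv_fls_coeffwise:
  assumes "\<And>a b. D (a + b) = D a + D b" "\<And>a b. D (a * b) = D a * b + a * D b"
  shows "fls_coeffwise D (f + g) = fls_coeffwise D f + fls_coeffwise D g"
    "fls_coeffwise D (f * g) = fls_coeffwise D f * g + f * fls_coeffwise D g"
proof -
  have 0: "D 0 = 0" using assms(1)[of 0 0] by simp
  have s: "D (sum h A) = (\<Sum>i\<in>A. D (h i))" for h and A :: "int set"
    by (induction A rule: infinite_finite_induct) (simp_all add: 0 assms)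
  show "fls_coeffwise D (f + g) = fls_coeffwise D f + fls_coeffwise D g"
    by (rule fls_eqI) (simp add: fls_coeffwise_nth 0 assms)
  have v: "vge (fls_subdegree f) (fls_coeffwise D f)" for f
    by (simp add: vge_def fls_coeffwise_nth 0)
  show "fls_coeffwise D (f * g) = fls_coeffwise D f * g + f * fls_coeffwise D g"
  proof (rule fls_eqI)
    fix n
    show "fls_coeffwise D (f * g) $$ n = (fls_coeffwise D f * g + f * fls_coeffwise D g) $$ n"
      unfolding fls_plus_nth nth_mult_conv[OF v[of f] vge_subdegree[of g]]
        nth_mult_conv[OF vge_subdegree[of f] v[of g]] fls_coeffwise_nth[of D, OF 0]
        nth_mult_conv[OF vge_subdegree[of f] vge_subdegree[of g]]
      by (simp add: s assms sum.distrib)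
  qed
qed

text \<open>The term of index j has valuation at least k j, so only the term of index j0 can reach
  the coefficient at k j0.\<close>

lemma poly_fls_leading:
  fixes p :: "'b::comm_ring_1 fls poly"
  assumes c: "\<And>j. vge 0 (coeff p j)" and y: "vge k y"
    and j0: "\<And>j. coeff p j \<noteq> 0 \<Longrightarrow> j \<noteq> j0 \<Longrightarrow> k * int j0 < k * int j"
  shows "vge (k * int j0) (poly p y) \<and> poly p y $$ (k * int j0) = coeff p j0 $$ 0 * (y $$ k) ^ j0"
proof -
  have v: "vge (k * int j) (coeff p j * y ^ j)" for j
    using vge_mult[OF c vge_power[OF y], of j j] by simp
  have z: "vge (k * int j0 + 1) (coeff p j * y ^ j)" if "j \<noteq> j0" for j
    using j0[of j] v[of j] that by (cases "coeff p j = 0") (auto intro: vge_mono)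
  \<comment> \<open>The range extends to \<open>max j0 (degree p)\<close> so that the term of index
    j0 can be split off even if its coefficient is 0.\<close>
  have e: "poly p y = (\<Sum>j\<le>max j0 (degree p). coeff p j * y ^ j)"
    unfolding poly_altdef by (rule sum.mono_neutral_left) (auto simp: not_le coeff_eq_0)
  also have "\<dots> = coeff p j0 * y ^ j0 + (\<Sum>j\<in>{..max j0 (degree p)} - {j0}. coeff p j * y ^ j)"
    by (rule sum.remove) auto
  finally have e: "poly p y = coeff p j0 * y ^ j0 + (\<Sum>j\<in>{..max j0 (degree p)} - {j0}. coeff p j * y ^ j)" .
  have r: "vge (k * int j0 + 1) (\<Sum>j\<in>{..max j0 (degree p)} - {j0}. coeff p j * y ^ j)"
    by (rule vge_sum) (simp add: z)
  have "(coeff p j0 * y ^ j0) $$ (0 + k * int j0) = coeff p j0 $$ 0 * (y $$ k) ^ j0"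
    by (simp only: nth_mult_vge[OF c vge_power[OF y]] nth_power_vge[OF y])
  then show ?thesis unfolding e
    using r vge_add[OF v vge_mono[OF r]] by (simp add: vge_def)
qed

text \<open>For k > 0 the lowest nonzero coefficient dominates, for k < 0 the highest.\<close>

lemma poly_leading_index:
  assumes "p \<noteq> 0" "k \<noteq> (0::int)"
  shows "\<exists>j0. coeff p j0 \<noteq> 0 \<and> (\<forall>j. coeff p j \<noteq> 0 \<longrightarrow> j \<noteq> j0 \<longrightarrow> k * int j0 < k * int j)"
proof (cases "k > 0")
  case True
  have "coeff p (degree p) \<noteq> 0" using assms by simp
  then have "coeff p (LEAST j. coeff p j \<noteq> 0) \<noteq> 0" by (rule LeastI)
  moreover have "k * int (LEAST j. coeff p j \<noteq> 0) < k * int j"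
    if "coeff p j \<noteq> 0" "j \<noteq> (LEAST j. coeff p j \<noteq> 0)" for j
    using that True Least_le[of "\<lambda>j. coeff p j \<noteq> 0" j] by simp
  ultimately show ?thesis by blast
next
  case False
  have "k * int (degree p) < k * int j" if "coeff p j \<noteq> 0" "j \<noteq> degree p" for j
    using that False assms le_degree[of p j] by simp
  then show ?thesis using assms by (intro exI[of _ "degree p"]) auto
qed

text \<open>Nonzero coefficients have valuation exactly 0, so the terms are separated by the powers
  of \<open>y\<close> and cannot cancel at the lowest order. Transcendence statements and valuations
  of polynomials in one generator are read off from this.\<close>

lemma hom_eval_leading:
  fixes h :: "'a::comm_ring_1 \<Rightarrow> 'b::field fls"
  assumes h: "is_hom h" and c: "\<And>a. vge 0 (h a)" and nz: "\<And>a. a \<noteq> 0 \<Longrightarrow> h a $$ 0 \<noteq> 0"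
    and y: "vge k y" and F: "F \<noteq> 0" "k \<noteq> 0"
  obtains j where "coeff F j \<noteq> 0" "vge (k * int j) (hom_eval h y F)"
    "hom_eval h y F $$ (k * int j) = h (coeff F j) $$ 0 * (y $$ k) ^ j"
    "k < 0 \<longrightarrow> j = degree F"
proof -
  obtain j where j: "coeff F j \<noteq> 0" "\<And>i. coeff F i \<noteq> 0 \<Longrightarrow> i \<noteq> j \<Longrightarrow> k * int j < k * int i"
    using poly_leading_index[OF F] by blast
  have cm: "coeff (map_poly h F) i = h (coeff F i)" for i
    by (simp add: coeff_map_poly hom_0[OF h])
  have jj: "k * int j < k * int i" if "h (coeff F i) \<noteq> 0" "i \<noteq> j" for i
    using that j(2) hom_0[OF h] by metis
  have L: "vge (k * int j) (hom_eval h y F) \<and>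
      hom_eval h y F $$ (k * int j) = h (coeff F j) $$ 0 * (y $$ k) ^ j"
    using poly_fls_leading[of "map_poly h F" k y j, unfolded cm, OF c y jj]
    by (simp add: hom_eval_def)
  have "j = degree F" if "k < 0"
  proof (rule ccontr)
    assume "j \<noteq> degree F"
    with j(1) have "j < degree F" using le_degree[of F j] by simp
    moreover have "k * int j < k * int (degree F)" using j(2)[of "degree F"] F \<open>j \<noteq> degree F\<close> by simp
    ultimately show False using that by simp
  qed
  then show ?thesis
    using that[OF j(1) conjunct1[OF L] conjunct2[OF L]] by iprover
qed

section \<open>Derivations that respect the valuation\<close>

definition vge_poly :: "int \<Rightarrow> 'a::zero fls poly \<Rightarrow> bool" where
  "vge_poly n p \<longleftrightarrow> (\<forall>i. vge n (coeff p i))"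

text \<open>The leading form belonging to the Gauss valuation \<open>vge_poly\<close>: at a
  valuation bound n it is multiplicative and has coefficients in the residue field.\<close>

definition coeff_poly :: "int \<Rightarrow> 'a::zero fls poly \<Rightarrow> 'a poly" where
  "coeff_poly n p = map_poly (\<lambda>f. f $$ n) p"

lemma coeff_coeff_poly: "coeff (coeff_poly n p) i = coeff p i $$ n"
  by (simp add: coeff_poly_def coeff_map_poly)

lemma vge_poly_diff: "vge_poly n p \<Longrightarrow> vge_poly n q \<Longrightarrow> vge_poly n (p - q :: 'a::comm_ring_1 fls poly)"
  by (simp add: vge_poly_def vge_diff)

lemma coeff_poly_diff: "coeff_poly n (p - q :: 'a::comm_ring_1 fls poly) = coeff_poly n p - coeff_poly n q"
  by (rule poly_eqI) (simp add: coeff_coeff_poly)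

lemma coeff_poly_sum: "coeff_poly n (sum f A :: 'a::comm_ring_1 fls poly) = (\<Sum>i\<in>A. coeff_poly n (f i))"
  by (rule poly_eqI) (simp add: coeff_coeff_poly coeff_sum nth_sum)

lemma
  fixes p q :: "'a::comm_ring_1 fls poly"
  assumes "vge_poly m p" "vge_poly n q"
  shows vge_poly_mult: "vge_poly (m + n) (p * q)"
    and coeff_poly_mult: "coeff_poly (m + n) (p * q) = coeff_poly m p * coeff_poly n q"
proof -
  have *: "vge m (coeff p i)" "vge n (coeff q i)" for i using assms by (auto simp: vge_poly_def)
  show "vge_poly (m + n) (p * q)"
    unfolding vge_poly_def coeff_mult using * by (intro allI vge_sum vge_mult) auto
  show "coeff_poly (m + n) (p * q) = coeff_poly m p * coeff_poly n q"
    by (rule poly_eqI) (simp add: coeff_coeff_poly coeff_mult nth_sum nth_mult_vge[OF *])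
qed

lemma
  fixes p :: "'a::comm_ring_1 fls poly"
  assumes "vge_poly n p"
  shows vge_poly_power: "vge_poly (n * int k) (p ^ k)"
    and coeff_poly_power: "coeff_poly (n * int k) (p ^ k) = coeff_poly n p ^ k"
proof -
  have "vge_poly (n * int k) (p ^ k) \<and> coeff_poly (n * int k) (p ^ k) = coeff_poly n p ^ k"
  proof (induction k)
    case 0
    have "coeff_poly 0 (1 :: 'a fls poly) = 1"
      by (rule poly_eqI) (simp add: coeff_coeff_poly coeff_1)
    then show ?case by (simp add: vge_poly_def vge_def)
  next
    case (Suc k)
    have e: "n * int (Suc k) = n + n * int k" by (simp add: algebra_simps)
    show ?case unfolding e power_Suc
      using vge_poly_mult[OF assms] coeff_poly_mult[OF assms] Suc by auto
  qed
  then show "vge_poly (n * int k) (p ^ k)" "coeff_poly (n * int k) (p ^ k) = coeff_poly n p ^ k"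
    by auto
qed

lemma coeff_poly_smult_const:
  "coeff_poly n (smult (fls_const c) p :: 'a::comm_ring_1 fls poly) = smult c (coeff_poly n p)"
  by (rule poly_eqI) (simp add: coeff_coeff_poly)

lemma nth_of_nat_mult: "(of_nat k * f :: 'a::comm_ring_1 fls) $$ n = of_nat k * f $$ n"
  by (simp add: fls_of_nat)

lemma
  fixes p :: "'a::idom fls poly"
  assumes "vge_poly n p"
  shows vge_poly_pderiv: "vge_poly n (pderiv p)"
    and coeff_poly_pderiv: "coeff_poly n (pderiv p) = pderiv (coeff_poly n p)"
proof -
  show "vge_poly n (pderiv p)"
    using assms by (simp add: vge_poly_def vge_def coeff_pderiv nth_of_nat_mult del: of_nat_Suc)
  show "coeff_poly n (pderiv p) = pderiv (coeff_poly n p)"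
    by (rule poly_eqI) (simp add: coeff_coeff_poly coeff_pderiv nth_of_nat_mult del: of_nat_Suc)
qed

text \<open>The coefficients are constants of \<open>D\<close>, so on \<open>poly p y\<close> the
  derivation acts through \<open>y\<close> alone. The polynomials used later have coefficients in
  k[\<xi>].\<close>

definition kills_coeffs :: "('a::zero \<Rightarrow> 'a) \<Rightarrow> 'a poly \<Rightarrow> bool" where
  "kills_coeffs D p \<longleftrightarrow> (\<forall>i. D (coeff p i) = 0)"

lemma deriv_of_nat: "is_deriv D \<Longrightarrow> D (of_nat n) = 0"
  by (induction n) (simp_all add: deriv_0 deriv_1 deriv_add)

lemma deriv_sum: "is_deriv D \<Longrightarrow> D (sum f A) = (\<Sum>i\<in>A. D (f i))"
  by (induction A rule: infinite_finite_induct) (simp_all add: deriv_0 deriv_add)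

lemma kills_coeffs_pderiv:
  fixes D :: "'a::idom \<Rightarrow> 'a"
  shows "is_deriv D \<Longrightarrow> kills_coeffs D p \<Longrightarrow> kills_coeffs D (pderiv p)"
  by (simp add: kills_coeffs_def coeff_pderiv deriv_mult deriv_of_nat del: of_nat_Suc)

lemma kills_coeffs_mult:
  "is_deriv D \<Longrightarrow> kills_coeffs D p \<Longrightarrow> kills_coeffs D q \<Longrightarrow> kills_coeffs D (p * q)"
  by (simp add: kills_coeffs_def coeff_mult deriv_sum deriv_mult)

lemma kills_coeffs_diff:
  "is_deriv D \<Longrightarrow> kills_coeffs D p \<Longrightarrow> kills_coeffs D q \<Longrightarrow> kills_coeffs D (p - q)"
  by (simp add: kills_coeffs_def deriv_diff)

lemma kills_coeffs_smult:
  "is_deriv D \<Longrightarrow> D c = 0 \<Longrightarrow> kills_coeffs D p \<Longrightarrow> kills_coeffs D (smult c p)"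
  by (simp add: kills_coeffs_def deriv_mult)

lemma kills_coeffs_sum:
  "is_deriv D \<Longrightarrow> (\<And>i. i \<in> A \<Longrightarrow> kills_coeffs D (f i)) \<Longrightarrow> kills_coeffs D (sum f A)"
  by (simp add: kills_coeffs_def coeff_sum deriv_sum)

lemma kills_coeffs_power:
  "is_deriv D \<Longrightarrow> kills_coeffs D p \<Longrightarrow> kills_coeffs D (p ^ n)"
proof (induction n)
  case 0
  then show ?case by (auto simp: kills_coeffs_def coeff_1 deriv_0 deriv_1)
qed (simp add: kills_coeffs_mult)

lemma deriv_poly_eval:
  assumes D: "is_deriv D" and "kills_coeffs D p"
  shows "D (poly p x) = poly (pderiv p) x * D x"
  using assms(2)
proof (induction p)
  case (pCons a p)
  then have "D a = 0" "kills_coeffs D p" 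
    unfolding kills_coeffs_def by (metis coeff_pCons_0, metis coeff_pCons_Suc)
  then show ?case using pCons by (simp add: deriv_add[OF D] deriv_mult[OF D] pderiv_pCons algebra_simps)
qed (simp add: deriv_0[OF D])

context
  fixes D :: "'b::field_char_0 fls \<Rightarrow> 'b fls" and z y :: "'b fls"
  assumes D: "is_deriv D" and D_vge: "\<And>n f. vge n f \<Longrightarrow> vge n (D f)"
    and z: "D z = 0" "vge 0 z" and y: "D y = z * y"
begin

text \<open>The substitution $y \mapsto y(1 + zT)$ linearises the flow of \<open>D\<close> and does not lower the
  valuation: up to $i!$, the coefficients of the result arise from \<open>poly p y\<close> by applying the
  operators $D - iz$.\<close>

lemma vge_poly_flow:
  assumes p: "kills_coeffs D p" and v: "vge n (poly p y)"
  shows "vge_poly n (pcompose p [:y, y * z:])"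
  unfolding vge_poly_def
proof
  fix i
  \<comment> \<open>\<open>e i\<close> is the i-th derivative of p(y(1 + zT)) at T = 0, that is, i!
    times the coefficient to be bounded.\<close>
  define e where "e i = poly ((pderiv ^^ i) p) y * (y * z) ^ i" for i
  have k: "kills_coeffs D ((pderiv ^^ i) p)" for i
    by (induction i) (simp_all add: p kills_coeffs_pderiv[OF D])
  have De: "D (e i) = e (Suc i) + of_nat i * z * e i" for i
  proof -
    have 1: "D ((y * z) ^ i) = of_nat i * z * (y * z) ^ i"
      by (induction i) (simp_all add: deriv_1[OF D] deriv_mult[OF D] y z algebra_simps)
    have 2: "D (poly ((pderiv ^^ i) p) y) = poly (pderiv ((pderiv ^^ i) p)) y * (y * z)"
      unfolding deriv_poly_eval[OF D k] y by (simp add: mult.commute)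
    show ?thesis unfolding e_def deriv_mult[OF D, of "poly _ _"] 1 2 by (simp add: algebra_simps)
  qed
  have "vge n (e i)"
  proof (induction i)
    case 0
    then show ?case using v by (simp add: e_def)
  next
    case (Suc i)
    have "vge (0 + n) (fls_const (of_nat i) * z * e i)"
      using vge_mult[OF vge_mult[OF vge_fls_const z(2)] Suc] by simp
    then show ?case using De[of i] D_vge[OF Suc] vge_diff[of n "D (e i)" "of_nat i * z * e i"]
      by (simp add: fls_of_nat)
  qed
  have "(pderiv ^^ i) (pcompose p [:y, y * z:]) =
      smult ((y * z) ^ i) (pcompose ((pderiv ^^ i) p) [:y, y * z:])" for i
    by (induction i) (simp_all add: pderiv_smult pderiv_pcompose pderiv_pCons algebra_simps)
  then have "e i = poly ((pderiv ^^ i) (pcompose p [:y, y * z:])) 0"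
    by (simp add: e_def poly_pcompose)
  also have "\<dots> = fact i * coeff (pcompose p [:y, y * z:]) i"
    by (simp add: poly_0_coeff_0 coeff_higher_pderiv pochhammer_fact)
  finally have "coeff (pcompose p [:y, y * z:]) i = fls_const (inverse (fact i)) * e i"
  proof -
    assume "e i = fact i * coeff (pcompose p [:y, y * z:]) i"
    moreover have "fact i = (fls_const (fact i) :: 'b fls)"
      by (metis fls_of_nat of_nat_fact)
    ultimately show ?thesis by (simp flip: mult.assoc)
  qed
  then show "vge n (coeff (pcompose p [:y, y * z:]) i)"
    using vge_mult[OF vge_fls_const \<open>vge n (e i)\<close>, of "inverse (fact i)"] by simp
qed

text \<open>A solution $X = F(y)/G(y)$ of $D X = \sum_i h_i X^i$ modulo positive valuation is deformed by
  the flow into an exact rational solution over the residue field.\<close>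

lemma approximate_solution_is_root:
  assumes F: "kills_coeffs D F" and G: "kills_coeffs D G" and Gy: "poly G y \<noteq> 0"
    and FG: "poly F y = X * poly G y" and X: "vge 0 X"
    and d: "d \<ge> 3" and hd: "h d \<noteq> 0" and Dh: "\<And>c. c \<in> range h \<Longrightarrow> D (fls_const c) = 0"
    and DX: "vge 1 (D X - (\<Sum>i\<le>d. fls_const (h i) * X ^ i))"
  shows "(\<Sum>i\<le>d. h i * (X $$ 0) ^ i) = 0"
proof -
  define n where "n = fls_subdegree (poly G y)"
  define W where "W = [:y, y * z:]"
  define fl where "fl p = pcompose p W" for p
  \<comment> \<open>On polynomials in y whose coefficients are constants of \<open>D\<close>, the
    derivation is the operator z y d/dy.\<close>
  define Q where "Q p = smult z ([:0, 1:] * pderiv p)" for p :: "'b fls poly"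
  define H where "H p q = (\<Sum>i\<le>d. smult (fls_const (h i)) (p ^ i * q ^ (d - i)))" for p q :: "'b fls poly"
  \<comment> \<open>The differential equation for F/G multiplied by G^d. Its value at y is G(y)^d
    times the error, which has valuation above n d; the flow preserves this bound, so the leading
    form at n d vanishes.\<close>
  define B where "B = (Q F * G - F * Q G) * G ^ (d - 2) - H F G"
  define F' where "F' = coeff_poly n (fl F)"
  define G' where "G' = coeff_poly n (fl G)"
  have vG: "vge n (poly G y)" by (simp add: n_def vge_subdegree)
  have vF: "vge n (poly F y)" unfolding FG using vge_mult[OF X vG] by simp
  have fG: "vge_poly n (fl G)" and fF: "vge_poly n (fl F)"
    unfolding fl_def W_def by (intro vge_poly_flow F G vG vF)+
  have d2: "2 + (d - 2) = d" using d by simp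
  have kQ: "kills_coeffs D (Q p)" if "kills_coeffs D p" for p
    unfolding Q_def using that
    by (intro kills_coeffs_smult kills_coeffs_mult kills_coeffs_pderiv D z)
      (auto simp: kills_coeffs_def coeff_pCons deriv_0[OF D] deriv_1[OF D] split: nat.split)
  have "kills_coeffs D B"
    unfolding B_def H_def using Dh
    by (intro kills_coeffs_diff kills_coeffs_mult kills_coeffs_sum kills_coeffs_smult kills_coeffs_power
        kQ F G D) auto
  moreover have "vge (n * int d + 1) (poly B y)"
  proof -
    have Qy: "poly (Q p) y = D (poly p y)" if "kills_coeffs D p" for p
      using that by (simp add: Q_def deriv_poly_eval[OF D] y)
    have 1: "poly (H F G) y = poly G y ^ d * (\<Sum>i\<le>d. fls_const (h i) * X ^ i)"
      unfolding H_def poly_sum sum_distrib_left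
    proof (rule sum.cong[OF refl])
      fix i assume "i \<in> {..d}"
      then have "poly G y ^ d = poly G y ^ i * poly G y ^ (d - i)" by (simp flip: power_add)
      then show "poly (smult (fls_const (h i)) (F ^ i * G ^ (d - i))) y =
          poly G y ^ d * (fls_const (h i) * X ^ i)"
        by (simp add: FG power_mult_distrib)
    qed
    have 2: "D (poly F y) * poly G y - poly F y * D (poly G y) = poly G y ^ 2 * D X"
      unfolding FG by (simp add: deriv_mult[OF D] power2_eq_square algebra_simps)
    have "poly B y = (D (poly F y) * poly G y - poly F y * D (poly G y)) * poly G y ^ (d - 2) - poly (H F G) y"
      unfolding B_def by (simp add: Qy F G)
    also have "\<dots> = (poly G y ^ 2 * poly G y ^ (d - 2)) * D X - poly (H F G) y"
      unfolding 2 by (simp add: mult_ac)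
    also have "\<dots> = poly G y ^ d * (D X - (\<Sum>i\<le>d. fls_const (h i) * X ^ i))"
      unfolding 1 power_add[symmetric] d2 by (simp add: right_diff_distrib)
    finally show ?thesis
      by (simp only: vge_mult[OF vge_power[OF vG] DX])
  qed
  ultimately have "vge_poly (n * int d + 1) (fl B)"
    unfolding fl_def W_def by (rule vge_poly_flow)
  then have B0: "coeff_poly (n * int d) (fl B) = 0"
    by (intro poly_eqI) (simp add: coeff_coeff_poly vge_poly_def vge_def)
  define E where "E = [:1, z $$ 0:]"
  \<comment> \<open>Under y \<mapsto> y(1 + zT) the operator z y d/dy becomes (1 + zT) d/dT. Its
    leading form is the linear factor \<open>E\<close>.\<close>
  have flQ: "fl (Q p) = [:1, z:] * pderiv (fl p)" for p
    unfolding fl_def Q_def W_def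
    by (simp add: pcompose_smult pcompose_mult pcompose_pCons pderiv_pcompose pderiv_pCons smult_add_right algebra_simps)
  have flB: "fl B = [:1, z:] * ((pderiv (fl F) * fl G - fl F * pderiv (fl G)) * fl G ^ (d - 2)) - H (fl F) (fl G)"
  proof -
    have p: "fl (p ^ k) = fl p ^ k" for p k
      by (induction k) (simp_all add: fl_def pcompose_mult pcompose_1)
    have "fl (H F G) = H (fl F) (fl G)"
      unfolding H_def fl_def pcompose_sum by (simp add: pcompose_smult pcompose_mult p[unfolded fl_def])
    moreover have "fl B = (fl (Q F) * fl G - fl F * fl (Q G)) * fl G ^ (d - 2) - fl (H F G)"
      unfolding p[symmetric] unfolding B_def fl_def by (simp only: pcompose_diff pcompose_mult)
    ultimately show ?thesis unfolding flQ by (simp add: algebra_simps)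
  qed
  have cH: "coeff_poly (n * int d) (H (fl F) (fl G)) = (\<Sum>i\<le>d. smult (h i) (F' ^ i * G' ^ (d - i)))"
    unfolding H_def coeff_poly_sum
  proof (rule sum.cong[OF refl])
    fix i assume "i \<in> {..d}"
    then have e: "n * int d = n * int i + n * int (d - i)" by (simp add: of_nat_diff algebra_simps)
    show "coeff_poly (n * int d) (smult (fls_const (h i)) (fl F ^ i * fl G ^ (d - i))) =
        smult (h i) (F' ^ i * G' ^ (d - i))"
      unfolding e F'_def G'_def coeff_poly_smult_const coeff_poly_mult[OF vge_poly_power[OF fF] vge_poly_power[OF fG]]
        coeff_poly_power[OF fF] coeff_poly_power[OF fG] ..
  qed
  have e: "n * int d = 0 + ((n + n) + n * int (d - 2))"
    using d by (simp add: of_nat_diff algebra_simps)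
  have vE: "vge_poly 0 [:1, z:]"
    using z(2) by (auto simp: vge_poly_def coeff_pCons vge_def split: nat.split)
  have cE: "coeff_poly 0 [:1, z:] = E"
    by (rule poly_eqI) (simp add: coeff_coeff_poly E_def coeff_pCons split: nat.split)
  have "coeff_poly (n * int d) ([:1, z:] * ((pderiv (fl F) * fl G - fl F * pderiv (fl G)) * fl G ^ (d - 2))) =
      E * ((pderiv F' * G' - F' * pderiv G') * G' ^ (d - 2))"
    unfolding e
    by (simp only: F'_def G'_def cE vE coeff_poly_mult vge_poly_mult coeff_poly_power vge_poly_power
        coeff_poly_pderiv vge_poly_pderiv coeff_poly_diff vge_poly_diff fF fG)
  then have eq: "E * (pderiv F' * G' - F' * pderiv G') * G' ^ (d - 2) =
      (\<Sum>i\<le>d. smult (h i) (F' ^ i * G' ^ (d - i)))"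
    using B0 unfolding flB coeff_poly_diff cH by (simp add: mult.assoc)
  \<comment> \<open>Setting T = 0 recovers the undeformed quotient, so the constant solution found
    below has to be the residue of X.\<close>
  have G0: "coeff G' 0 = poly G y $$ n" and F0: "coeff F' 0 = X $$ 0 * poly G y $$ n"
    using nth_mult_vge[OF X vG] by (simp_all add: G'_def F'_def coeff_coeff_poly fl_def W_def FG)
  have Gn: "poly G y $$ n \<noteq> 0" using Gy by (simp add: n_def)
  then have "G' \<noteq> 0" using G0 by auto
  moreover have degE: "degree E \<le> 1" by (simp add: E_def)
  ultimately obtain c where c: "F' = smult c G'" "(\<Sum>i\<le>d. h i * c ^ i) = 0"
    using no_rational_solution[where h = h, OF _ degE d hd eq] by blast
  have "c = X $$ 0" using c(1) F0 G0 Gn by (metis coeff_smult mult_right_cancel)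
  then show ?thesis using c(2) by simp
qed

end

lemma hom_eval_deriv:
  assumes h: "is_hom h" and E: "is_deriv E" and D: "\<And>a. E (h a) = h (D a)" "D 0 = 0"
  shows "E (hom_eval h x p) = hom_eval h x (map_poly D p) + hom_eval h x (pderiv p) * E x"
proof (induction p)
  case (pCons a p)
  show ?case
    by (simp add: hom_eval_pCons[OF h] map_poly_pCons D deriv_add[OF E] deriv_mult[OF E] pCons
        pderiv_pCons hom_add[OF hom_hom_eval[OF h]] hom_0[OF h] algebra_simps)
qed (simp add: deriv_0[OF E])

lemma hom_poly_eq_hom_eval:
  assumes g: "is_hom g"
  shows "g p = hom_eval (\<lambda>a. g [:a:]) (g [:0, 1:]) p"
proof (induction p)
  case (pCons a p)
  have "pCons a p = [:a:] + [:0, 1:] * p" by simp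
  then have "g (pCons a p) = g [:a:] + g [:0, 1:] * g p" by (metis hom_add[OF g] hom_mult[OF g])
  then show ?case using pCons by (simp add: hom_eval_pCons hom_comp[OF g hom_const_poly])
qed (simp add: hom_0 g)

section \<open>The embedding of $k(x,y)$ into $k(x)((y))$\<close>

abbreviation rat_of_poly :: "'a::field_char_0 poly \<Rightarrow> 'a poly fract fls" where
  "rat_of_poly p \<equiv> fls_const (to_fract p)"

abbreviation cst :: "'a::field_char_0 \<Rightarrow> 'a poly fract fls" where
  "cst c \<equiv> rat_of_poly [:c:]"

lemma hom_rat_of_poly: "is_hom rat_of_poly"
  using hom_comp[OF hom_fls_const hom_to_fract] .

lemma hom_cst: "is_hom cst"
  using hom_comp[OF hom_rat_of_poly hom_const_poly] .

definition ddx :: "'a::field_char_0 poly fract \<Rightarrow> 'a poly fract" where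
  "ddx = fract_deriv pderiv"

lemma is_deriv_ddx: "is_deriv ddx"
  unfolding ddx_def by (rule is_deriv_fract_deriv[OF is_deriv_pderiv])

lemma ddx_to_fract: "ddx (to_fract p) = to_fract (pderiv p)"
  unfolding ddx_def by (rule fract_deriv_to_fract[OF is_deriv_pderiv])

text \<open>On $k(x)((y))$ the operators $\partial_x$ and $y\,\partial_y$ both act coefficientwise.\<close>

definition fls_dx :: "'a::field_char_0 poly fract fls \<Rightarrow> 'a poly fract fls" where
  "fls_dx = fls_coeffwise ddx"

definition fls_theta :: "'a::field_char_0 poly fract fls \<Rightarrow> 'a poly fract fls" where
  "fls_theta f = fls_X * fls_deriv f"

lemma fls_dx_nth: "fls_dx f $$ n = ddx (f $$ n)"
  unfolding fls_dx_def by (rule fls_coeffwise_nth[of ddx, OF deriv_0[OF is_deriv_ddx]])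

lemma fls_theta_nth: "fls_theta f $$ n = of_int n * f $$ n"
  by (simp add: fls_theta_def fls_X_times_conv_shift)

lemma is_deriv_fls_dx: "is_deriv fls_dx"
  unfolding fls_dx_def
  by (rule is_derivI)
    (rule is_deriv_fls_coeffwise[of ddx, OF deriv_add[OF is_deriv_ddx] deriv_mult[OF is_deriv_ddx]])+

lemma is_deriv_fls_theta: "is_deriv fls_theta"
  by (rule is_derivI) (simp_all add: fls_theta_def algebra_simps)

text \<open>The bracket with {x, y} = P(x) y. The factor y is absorbed into
  \<open>fls_theta\<close>, so that no operator involved lowers the valuation.\<close>

definition fls_bracket ::
  "'a::field_char_0 poly \<Rightarrow> 'a poly fract fls \<Rightarrow> 'a poly fract fls \<Rightarrow> 'a poly fract fls" where
  "fls_bracket P f g = (fls_dx f * fls_theta g - fls_theta f * fls_dx g) * rat_of_poly P"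

text \<open>Both operators act coefficientwise, so only the leading terms matter: {a y^m, b y^n} =
  (n a' b - m a b') P y^(m + n).\<close>

lemma
  assumes f: "vge m f" and g: "vge n g"
  shows vge_fls_bracket: "vge (m + n) (fls_bracket P f g)"
    and nth_fls_bracket: "fls_bracket P f g $$ (m + n) =
      (of_int n * ddx (f $$ m) * g $$ n - of_int m * f $$ m * ddx (g $$ n)) * to_fract P"
proof -
  have d: "vge m (fls_dx f)" "vge n (fls_dx g)" "vge m (fls_theta f)" "vge n (fls_theta g)"
    using f g by (simp_all add: vge_def fls_dx_nth fls_theta_nth deriv_0[OF is_deriv_ddx])
  have 1: "vge (m + n) (fls_dx f * fls_theta g - fls_theta f * fls_dx g)"
    by (intro vge_diff vge_mult d)
  show "vge (m + n) (fls_bracket P f g)"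
    using vge_mult[OF 1 vge_fls_const] by (simp add: fls_bracket_def)
  show "fls_bracket P f g $$ (m + n) =
      (of_int n * ddx (f $$ m) * g $$ n - of_int m * f $$ m * ddx (g $$ n)) * to_fract P"
    unfolding fls_bracket_def fls_mult_const_nth fls_minus_nth nth_mult_vge[OF d(1,4)] nth_mult_vge[OF d(3,2)]
    by (simp add: fls_dx_nth fls_theta_nth mult_ac)
qed

lemma is_deriv_fls_bracket: "is_deriv (fls_bracket P f)"
  by (rule is_derivI)
    (simp_all add: fls_bracket_def deriv_add[OF is_deriv_fls_dx] deriv_add[OF is_deriv_fls_theta]
      deriv_mult[OF is_deriv_fls_dx] deriv_mult[OF is_deriv_fls_theta] algebra_simps)

lemma fls_bracket_swap: "fls_bracket P g f = - fls_bracket P f g"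
  by (simp add: fls_bracket_def algebra_simps)

lemma fls_bracket_self: "fls_bracket P f f = 0"
  by (simp add: fls_bracket_def algebra_simps)

lemma fls_bracket_const: "fls_bracket P f (cst c) = 0"
proof -
  have "fls_dx (cst c) = 0" "fls_theta (cst c) = 0"
    by (rule fls_eqI, simp add: fls_dx_nth fls_theta_nth ddx_to_fract pderiv_pCons deriv_0[OF is_deriv_ddx])+
  then show ?thesis by (simp add: fls_bracket_def)
qed

lemma fls_bracket_poly:
  "fls_bracket P f (hom_eval cst g p) = hom_eval cst g (pderiv p) * fls_bracket P f g"
proof -
  have z: "map_poly (\<lambda>_. 0) p = (0 :: 'a poly)" by (rule poly_eqI) (simp add: coeff_map_poly)
  show ?thesis
    using hom_eval_deriv[OF hom_cst is_deriv_fls_bracket[of P f], of "\<lambda>_. 0" g p] z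
    by (simp add: fls_bracket_const)
qed

text \<open>Here \<open>fls_X\<close> stands for y, while x lives in the coefficient field.\<close>

definition rf_to_fls :: "'a::field_char_0 ratfun2 \<Rightarrow> 'a poly fract fls" where
  "rf_to_fls = fract_lift (hom_eval rat_of_poly fls_X)"

lemma hom_eval_X_nonzero:
  assumes "F \<noteq> 0"
  shows "hom_eval rat_of_poly fls_X F \<noteq> 0"
proof -
  have v: "vge 1 (fls_X :: 'a poly fract fls)" by (simp add: vge_def)
  obtain j where "coeff F j \<noteq> 0"
    "hom_eval rat_of_poly fls_X F $$ (1 * int j) = rat_of_poly (coeff F j) $$ 0 * (fls_X $$ 1) ^ j"
    by (rule hom_eval_leading[OF hom_rat_of_poly vge_fls_const _ v assms]) auto
  then have "hom_eval rat_of_poly fls_X F $$ (1 * int j) \<noteq> 0" by simp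
  then show ?thesis by (metis fls_zero_nth)
qed

lemma rf_to_fls_to_fract: "rf_to_fls (to_fract F) = hom_eval rat_of_poly fls_X F"
  unfolding rf_to_fls_def
  by (rule fract_lift_to_fract) (simp_all add: hom_hom_eval hom_rat_of_poly hom_eval_X_nonzero)

lemma hom_rf_to_fls: "is_hom rf_to_fls"
  unfolding rf_to_fls_def
  by (rule hom_fract_lift) (simp_all add: hom_hom_eval hom_rat_of_poly hom_eval_X_nonzero)

lemma rf_to_fls_dx:
  fixes q :: "'a::field_char_0 ratfun2"
  shows "rf_to_fls (rf_dx q) = fls_dx (rf_to_fls q)"
proof -
  have X: "fls_dx (fls_X :: 'a poly fract fls) = 0"
    by (rule fls_eqI) (simp add: fls_dx_nth deriv_0[OF is_deriv_ddx] deriv_1[OF is_deriv_ddx])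
  have c: "fls_dx (rat_of_poly a) = rat_of_poly (pderiv a)" for a :: "'a poly"
    by (rule fls_eqI) (simp add: fls_dx_nth ddx_to_fract deriv_0[OF is_deriv_ddx])
  have "fls_dx (rf_to_fls (to_fract a)) = 1 * rf_to_fls (to_fract (map_poly pderiv a))"
    for a :: "'a poly poly"
    using hom_eval_deriv[OF hom_rat_of_poly is_deriv_fls_dx c, of fls_X a] X
    by (simp add: rf_to_fls_to_fract)
  from fract_deriv_transport[OF hom_rf_to_fls is_deriv_map_poly_pderiv is_deriv_fls_dx this, of q]
  show ?thesis by (simp add: rf_dx_def)
qed

lemma rf_to_fls_dy:
  fixes q :: "'a::field_char_0 ratfun2"
  shows "rf_to_fls (rf_dy q) = fls_deriv (rf_to_fls q)"
proof -
  have z: "map_poly (\<lambda>_. 0) p = (0 :: 'a poly poly)" for p :: "'a poly poly"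
    by (rule poly_eqI) (simp add: coeff_map_poly)
  have "fls_deriv (rf_to_fls (to_fract a)) = 1 * rf_to_fls (to_fract (pderiv a))"
    for a :: "'a poly poly"
    using hom_eval_deriv[OF hom_rat_of_poly is_deriv_fls_deriv, of "\<lambda>_. 0" fls_X a]
    by (simp add: rf_to_fls_to_fract z)
  from fract_deriv_transport[OF hom_rf_to_fls is_deriv_pderiv is_deriv_fls_deriv this, of q]
  show ?thesis by (simp add: rf_dy_def)
qed

lemma rf_of_poly_x_conv: "rf_of_poly_x p = to_fract [:p:]"
  by (simp add: rf_of_poly_x_def to_fract_def)

lemma rf_X_conv: "rf_X = to_fract [:[:0, 1:]:]"
  by (simp add: rf_X_def rf_of_poly_x_conv)

lemma rf_Y_conv: "rf_Y = to_fract [:0, 1:]"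
  by (simp add: rf_Y_def to_fract_def)

lemma rf_const_conv: "rf_const c = to_fract [:[:c:]:]"
  by (simp add: rf_const_def to_fract_def)

lemma
  shows rf_to_fls_of_poly_x: "rf_to_fls (rf_of_poly_x p) = rat_of_poly p"
    and rf_to_fls_Y: "rf_to_fls rf_Y = fls_X"
  by (simp_all add: rf_of_poly_x_conv rf_Y_conv rf_to_fls_to_fract hom_eval_pCons hom_rat_of_poly
      hom_1[OF hom_rat_of_poly])

lemma rf_to_fls_bracket:
  "rf_to_fls (rf_bracket (rf_of_poly_x p * rf_X * rf_Y) g h) =
    fls_bracket ([:0, 1:] * p) (rf_to_fls g) (rf_to_fls h)"
proof -
  have "rat_of_poly ([:0, 1:] * p) = rat_of_poly p * rat_of_poly [:0, 1:]"
    by (simp only: hom_mult[OF hom_rat_of_poly] mult.commute)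
  moreover have "rf_to_fls (rf_bracket (rf_of_poly_x p * rf_X * rf_Y) g h) =
      (fls_dx (rf_to_fls g) * fls_deriv (rf_to_fls h) - fls_deriv (rf_to_fls g) * fls_dx (rf_to_fls h)) *
      (rat_of_poly p * rat_of_poly [:0, 1:] * fls_X)"
    unfolding rf_bracket_def rf_X_def hom_mult[OF hom_rf_to_fls] hom_diff[OF hom_rf_to_fls]
      rf_to_fls_dx rf_to_fls_dy rf_to_fls_of_poly_x rf_to_fls_Y ..
  ultimately show ?thesis
    by (simp only: fls_bracket_def fls_theta_def algebra_simps)
qed

text \<open>$\xi$ and $\eta$ are the images of $x$ and $y$; the last three assumptions say that they are
  algebraically independent over $k$ and generate $k(x,y)$.\<close>

locale poisson_embedding =
  fixes P1 P2 :: "'a::field_char_0 poly" and \<xi> \<eta> :: "'a poly fract fls"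
  assumes bracket: "fls_bracket P1 \<xi> \<eta> = hom_eval cst \<xi> P2 * \<eta>"
    and nonzero: "G \<noteq> 0 \<Longrightarrow> hom_eval (hom_eval cst \<xi>) \<eta> G \<noteq> 0"
    and generate_x: "\<exists>F G. G \<noteq> 0 \<and>
      hom_eval (hom_eval cst \<xi>) \<eta> F = rat_of_poly [:0, 1:] * hom_eval (hom_eval cst \<xi>) \<eta> G"
    and generate_y: "\<exists>F G. G \<noteq> 0 \<and>
      hom_eval (hom_eval cst \<xi>) \<eta> F = fls_X * hom_eval (hom_eval cst \<xi>) \<eta> G"

lemma poisson_iso_hom:
  assumes "poisson_iso f1 f2 \<phi>"
  shows "is_hom \<phi>"
proof (rule is_homI)
  have "rf_const 1 = (1 :: 'a ratfun2)" by (simp add: rf_const_conv one_pCons[symmetric])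
  then show "\<phi> 1 = 1" using assms unfolding poisson_iso_def by metis
qed (use assms in \<open>auto simp: poisson_iso_def\<close>)

text \<open>The images of the source generators satisfy the source relation, given by p2, for the
  target bracket, given by p1. Generation follows from surjectivity: write a preimage as a fraction
  and clear the denominator.\<close>

lemma poisson_embedding_of_iso:
  assumes iso: "poisson_iso (rf_of_poly_x p2 * rf_X * rf_Y) (rf_of_poly_x p1 * rf_X * rf_Y) \<phi>"
  shows "poisson_embedding ([:0, 1:] * p1) ([:0, 1:] * p2)
    (rf_to_fls (\<phi> rf_X)) (rf_to_fls (\<phi> rf_Y))"
proof -
  define \<Phi> where "\<Phi> q = rf_to_fls (\<phi> q)" for q
  have \<Phi>: "is_hom \<Phi>" 
    unfolding \<Phi>_def using hom_comp[OF hom_rf_to_fls poisson_iso_hom[OF iso]] .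
  have c: "\<Phi> (to_fract [:[:c:]:]) = cst c" for c
    using iso by (simp add: \<Phi>_def poisson_iso_def flip: rf_const_conv)
      (simp add: rf_const_def rf_of_poly_x_def[symmetric] rf_to_fls_of_poly_x)
  have px: "\<Phi> (rf_of_poly_x p) = hom_eval cst (\<Phi> rf_X) p" for p
    using hom_poly_eq_hom_eval[of "\<lambda>p. \<Phi> (to_fract [:p:])" p] hom_comp[OF \<Phi> hom_comp[OF hom_to_fract hom_const_poly]]
    by (simp add: c rf_of_poly_x_conv rf_X_conv)
  have ev: "\<Phi> (to_fract F) = hom_eval (hom_eval cst (\<Phi> rf_X)) (\<Phi> rf_Y) F" for F
    using hom_poly_eq_hom_eval[OF hom_comp[OF \<Phi> hom_to_fract], of F]
    by (simp add: px[unfolded rf_of_poly_x_conv] rf_Y_conv)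
  have gen: "\<exists>F G. G \<noteq> 0 \<and> hom_eval (hom_eval cst (\<Phi> rf_X)) (\<Phi> rf_Y) F =
      rf_to_fls w * hom_eval (hom_eval cst (\<Phi> rf_X)) (\<Phi> rf_Y) G" for w
  proof -
    obtain q where q: "\<phi> q = w" using iso unfolding poisson_iso_def bij_def by (metis surjD)
    obtain F G where FG: "q = Fract F G" "G \<noteq> 0" by (cases q)
    then have "to_fract F = q * to_fract G" by (simp add: to_fract_def eq_fract)
    then have "\<Phi> (to_fract F) = \<Phi> q * \<Phi> (to_fract G)" by (simp add: hom_mult[OF \<Phi>])
    then show ?thesis using FG(2) q ev by (auto simp: \<Phi>_def)
  qed
  show ?thesis
    unfolding \<Phi>_def[symmetric]
  proof
    have "\<Phi> (rf_bracket (rf_of_poly_x p2 * rf_X * rf_Y) rf_X rf_Y) =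
        fls_bracket ([:0, 1:] * p1) (\<Phi> rf_X) (\<Phi> rf_Y)"
      using iso by (simp add: \<Phi>_def poisson_iso_def rf_to_fls_bracket)
    moreover have "\<Phi> (rf_of_poly_x p2 * rf_X * rf_Y) = hom_eval cst (\<Phi> rf_X) ([:0, 1:] * p2) * \<Phi> rf_Y"
      unfolding hom_mult[OF \<Phi>] px hom_mult[OF hom_hom_eval[OF hom_cst]]
      by (simp add: hom_eval_pCons hom_cst hom_0[OF hom_cst] hom_1[OF hom_cst] mult.commute)
    ultimately show "fls_bracket ([:0, 1:] * p1) (\<Phi> rf_X) (\<Phi> rf_Y) =
        hom_eval cst (\<Phi> rf_X) ([:0, 1:] * p2) * \<Phi> rf_Y"
      by (simp add: rf_bracket_X_Y)
    show "hom_eval (hom_eval cst (\<Phi> rf_X)) (\<Phi> rf_Y) G \<noteq> 0" if "G \<noteq> 0" for G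
      unfolding ev[symmetric] using that hom_eq_0_iff[OF \<Phi>] by simp
  qed (use gen[of rf_X] gen[of rf_Y] in \<open>simp_all add: rf_X_def rf_to_fls_of_poly_x rf_to_fls_Y\<close>)
qed

section \<open>Nonconstant residues\<close>

abbreviation cx :: "'a::field_char_0 \<Rightarrow> 'a poly fract" where
  "cx c \<equiv> to_fract [:c:]"

lemma hom_cx: "is_hom cx"
  using hom_comp[OF hom_to_fract hom_const_poly] .

lemma hom_eval_cx_to_fract: "hom_eval cx (to_fract q) p = to_fract (pcompose p q)"
  by (induction p) (simp_all add: hom_eval_pCons hom_cx pcompose_pCons)

lemma hom_eval_fls_const_leading:
  fixes z :: "'a::field_char_0 fls"
  assumes "vge k z" "z $$ k \<noteq> 0" "k \<noteq> 0" "p \<noteq> 0"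
  obtains j where "fls_subdegree (hom_eval fls_const z p) = k * int j" "hom_eval fls_const z p \<noteq> 0"
    "k < 0 \<longrightarrow> j = degree p"
proof -
  obtain j where j: "coeff p j \<noteq> 0" "vge (k * int j) (hom_eval fls_const z p)"
    "hom_eval fls_const z p $$ (k * int j) = fls_const (coeff p j) $$ 0 * (z $$ k) ^ j"
    "k < 0 \<longrightarrow> j = degree p"
    by (rule hom_eval_leading[OF hom_fls_const vge_fls_const _ assms(1,4,3)]) auto
  then have "hom_eval fls_const z p $$ (k * int j) \<noteq> 0" using assms by simp
  then show ?thesis using that[of j] j(2,4) subdegree_eq_vge by fastforce
qed

text \<open>The expansion of a rational function at $x = z$: taking \<open>fls_X\<close> for $z$ expands at $0$, and
  \<open>fls_X_inv\<close> at infinity.\<close>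

definition expand :: "'a::field_char_0 fls \<Rightarrow> 'a poly fract \<Rightarrow> 'a fls" where
  "expand z = fract_lift (hom_eval fls_const z)"

context
  fixes z :: "'a::field_char_0 fls" and k :: int
  assumes z: "vge k z" "z $$ k \<noteq> 0" "k \<noteq> 0"
begin

lemma hom_eval_fls_const_nonzero: "p \<noteq> 0 \<Longrightarrow> hom_eval fls_const z p \<noteq> 0"
  by (metis hom_eval_fls_const_leading z)

lemma hom_expand: "is_hom (expand z)"
  unfolding expand_def
  by (rule hom_fract_lift) (simp_all add: hom_hom_eval hom_fls_const hom_eval_fls_const_nonzero)

lemma expand_to_fract: "expand z (to_fract p) = hom_eval fls_const z p"
  unfolding expand_def
  by (rule fract_lift_to_fract) (simp_all add: hom_hom_eval hom_fls_const hom_eval_fls_const_nonzero)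

lemma expand_cx: "expand z (cx c) = fls_const c"
  by (simp add: expand_to_fract hom_eval_pCons hom_fls_const)

lemma expand_x: "expand z (to_fract [:0, 1:]) = z"
  by (simp add: expand_to_fract hom_eval_pCons hom_fls_const)

lemma expand_hom_eval: "expand z (hom_eval cx r p) = hom_eval fls_const (expand z r) p"
  by (simp add: hom_hom_eval_commute[OF hom_expand hom_cx] expand_cx)

text \<open>The chain rule in the expansion variable; at infinity the factor
  \<open>fls_deriv z\<close> is \<open>- (fls_X_inv ^ 2)\<close>.\<close>

lemma expand_ddx: "fls_deriv (expand z q) = fls_deriv z * expand z (ddx q)"
proof -
  have m: "map_poly (\<lambda>_. 0) p = (0 :: 'a poly)" for p :: "'a poly"
    by (rule poly_eqI) (simp add: coeff_map_poly)
  have "fls_deriv (expand z (to_fract a)) = fls_deriv z * expand z (to_fract (pderiv a))" for a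
    using hom_eval_deriv[OF hom_fls_const is_deriv_fls_deriv, of "\<lambda>_. 0" z a]
    by (simp add: expand_to_fract m)
  from fract_deriv_transport[OF hom_expand is_deriv_pderiv is_deriv_fls_deriv this, of q]
  show ?thesis by (simp add: ddx_def)
qed

lemma expand_not_const:
  assumes "\<And>c. r \<noteq> cx c"
  shows "expand z r \<noteq> fls_const c"
proof
  assume "expand z r = fls_const c"
  then have "expand z (r - cx c) = 0" by (simp add: hom_diff[OF hom_expand] expand_cx)
  then have "r - cx c = 0" using hom_eq_0_iff[OF hom_expand] by simp
  then show False using assms[of c] by simp
qed

end

text \<open>Subtracting the finite value leaves a series w of nonzero valuation, and shifting the
  polynomial turns evaluation at f into evaluation at w, where the powers have distinct
  valuations.\<close>

lemma nonconst_local_parameter: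
  fixes f :: "'a::field_char_0 fls"
  assumes nc: "\<And>c. f \<noteq> fls_const c"
  obtains c w k where "vge k w" "w $$ k \<noteq> 0" "k \<noteq> 0" "f = fls_const c + w"
    "k < 0 \<longrightarrow> c = 0" "\<And>p. hom_eval fls_const f p = hom_eval fls_const w (pcompose p [:c, 1:])"
proof -
  \<comment> \<open>At a pole there is no finite value; the default 0 leaves f unchanged.\<close>
  define c where "c = (if fls_subdegree f < 0 then 0 else f $$ 0)"
  define w where "w = f - fls_const c"
  have w0: "w \<noteq> 0" using nc[of c] by (simp add: w_def)
  have f: "f = fls_const c + w" by (simp add: w_def)
  have ev: "hom_eval fls_const f p = hom_eval fls_const w (pcompose p [:c, 1:])" for p
  proof (induction p)
    case (pCons a p)
    have "pcompose (pCons a p) [:c, 1:] = [:a:] + [:c, 1:] * pcompose p [:c, 1:]"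
      by (rule pcompose_pCons)
    then have "hom_eval fls_const w (pcompose (pCons a p) [:c, 1:]) =
        hom_eval fls_const w [:a:] + hom_eval fls_const w [:c, 1:] * hom_eval fls_const w (pcompose p [:c, 1:])"
      by (simp only: hom_add[OF hom_hom_eval[OF hom_fls_const]] hom_mult[OF hom_hom_eval[OF hom_fls_const]])
    then show ?case
      unfolding pCons(2)[symmetric] by (simp add: hom_eval_pCons hom_fls_const f)
  qed simp
  have k: "fls_subdegree w \<noteq> 0 \<and> (fls_subdegree w < 0 \<longrightarrow> c = 0)"
  proof (cases "fls_subdegree f < 0")
    case True
    then show ?thesis by (simp add: w_def c_def)
  next
    case False
    then have "vge 0 f" using vge_mono[OF vge_subdegree[of f]] by simp
    then have "vge 0 w" unfolding w_def by (rule vge_diff[OF _ vge_fls_const])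
    moreover have "w $$ 0 = 0" using False by (simp add: w_def c_def)
    ultimately have "vge 1 w"
      unfolding vge_def by (metis int_one_le_iff_zero_less linorder_cases not_le)
    then show ?thesis using vge_le_subdegree[OF _ w0] by fastforce
  qed
  show ?thesis using that[OF vge_subdegree, of w c] nth_subdegree[OF w0] k f ev by blast
qed

lemma nonconst_transcendental_fls:
  fixes f :: "'a::field_char_0 fls"
  assumes "\<And>c. f \<noteq> fls_const c" "p \<noteq> 0"
  shows "hom_eval fls_const f p \<noteq> 0"
proof -
  obtain c w k where "vge k w" "w $$ k \<noteq> 0" "k \<noteq> 0"
    "\<And>p. hom_eval fls_const f p = hom_eval fls_const w (pcompose p [:c, 1:])"
    by (rule nonconst_local_parameter[OF assms(1)]) blast
  moreover have "pcompose p [:c, 1:] \<noteq> 0" using assms(2) by (simp add: pcompose_eq_0_iff)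
  ultimately show ?thesis using hom_eval_fls_const_nonzero by metis
qed

lemma vge_fls_X: "vge 1 (fls_X :: 'a::field_char_0 fls)" "fls_X $$ 1 = (1 :: 'a::field_char_0)"
  by (simp_all add: vge_def)

lemma vge_fls_X_inv: "vge (-1) (fls_X_inv :: 'a::field_char_0 fls)" "fls_X_inv $$ (-1) = (1 :: 'a::field_char_0)"
  by (simp_all add: vge_def)

text \<open>Expanding at x = 0 reduces this to nonconstant Laurent series.\<close>

lemma nonconst_transcendental:
  fixes r :: "'a::field_char_0 poly fract"
  assumes "\<And>c. r \<noteq> cx c" "p \<noteq> 0"
  shows "hom_eval cx r p \<noteq> 0"
proof
  have z: "vge 1 (fls_X :: 'a fls)" "fls_X $$ 1 \<noteq> (0::'a)" "(1::int) \<noteq> 0"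
    by (simp_all add: vge_fls_X)
  assume "hom_eval cx r p = 0"
  then have "hom_eval fls_const (expand fls_X r) p = 0"
    unfolding expand_hom_eval[OF z, symmetric] by (simp add: hom_0[OF hom_expand[OF z]])
  then show False
    using nonconst_transcendental_fls expand_not_const[OF z assms(1)] assms(2) by blast
qed

text \<open>Compare valuations at x = infinity. Since x lies in k(r), the local order k of r is 1 or
  -1, and the equation rules out 1.\<close>

lemma degree_eq_of_residue_equation:
  fixes r :: "'a::field_char_0 poly fract"
  assumes nc: "\<And>c. r \<noteq> cx c" and t: "t \<noteq> (0::int)"
    and ode: "of_int t * ddx r * to_fract P1 = hom_eval cx r P2"
    and gen: "hom_eval cx r f = to_fract [:0, 1:] * hom_eval cx r g" "g \<noteq> 0"
    and P1: "degree P1 \<ge> 3" and P2: "P2 \<noteq> 0"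
  shows "degree P1 = degree P2"
proof -
  define \<rho> where "\<rho> = expand fls_X_inv r"
  have z: "vge (-1) (fls_X_inv :: 'a fls)" "fls_X_inv $$ (-1) \<noteq> (0::'a)" "(-1::int) \<noteq> 0"
    by (simp_all add: vge_fls_X_inv)
  note E = hom_expand[OF z] expand_hom_eval[OF z] expand_to_fract[OF z] expand_x[OF z]
  have "of_int t * expand fls_X_inv (ddx r) * hom_eval fls_const fls_X_inv P1 = hom_eval fls_const \<rho> P2"
    using arg_cong[OF ode, of "expand fls_X_inv"]
    by (simp add: hom_mult[OF E(1)] hom_of_int[OF E(1)] E(2,3) \<rho>_def)
  then have ode': "of_int t * fls_deriv \<rho> * hom_eval fls_const fls_X_inv P1 =
      - (fls_X_inv ^ 2) * hom_eval fls_const \<rho> P2"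
    unfolding \<rho>_def expand_ddx[OF z] by (simp add: algebra_simps)
  have gen': "hom_eval fls_const \<rho> f = fls_X_inv * hom_eval fls_const \<rho> g"
    using arg_cong[OF gen(1), of "expand fls_X_inv"] by (simp add: hom_mult[OF E(1)] E(2,4) \<rho>_def)
  obtain c w k where w: "vge k w" "w $$ k \<noteq> 0" "k \<noteq> 0" "\<rho> = fls_const c + w" "k < 0 \<longrightarrow> c = 0"
    and ev: "\<And>p. hom_eval fls_const \<rho> p = hom_eval fls_const w (pcompose p [:c, 1:])"
    by (rule nonconst_local_parameter[of \<rho>]) (use expand_not_const[OF z, of r] nc in \<open>auto simp: \<rho>_def\<close>)
  have pc: "p \<noteq> 0 \<Longrightarrow> pcompose p [:c, 1:] \<noteq> 0" for p
    by (simp add: pcompose_eq_0_iff)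
  \<comment> \<open>At infinity x has valuation -1 and is a quotient of polynomials in r, whose
    valuations are multiples of k; so k divides 1.\<close>
  have k: "k = 1 \<or> k = -1"
  proof -
    obtain j where j: "fls_subdegree (hom_eval fls_const \<rho> g) = k * int j" "hom_eval fls_const \<rho> g \<noteq> 0"
      unfolding ev by (rule hom_eval_fls_const_leading[OF w(1-3) pc[OF gen(2)]])
    then have nz: "hom_eval fls_const \<rho> f \<noteq> 0" unfolding gen' by simp
    then have "f \<noteq> 0" by auto
    then obtain i where i: "fls_subdegree (hom_eval fls_const \<rho> f) = k * int i"
      unfolding ev by (rule hom_eval_fls_const_leading[OF w(1-3) pc])
    have "k * int i = -1 + k * int j" using i j unfolding gen' by simp
    then have "k * (int j - int i) = 1" by (simp add: algebra_simps)
    then show ?thesis by (metis zmult_eq_1_iff)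
  qed
  have d\<rho>: "fls_deriv \<rho> = fls_deriv w" using w(4) by simp
  have *: "vge (k - 1) (fls_deriv w)" "fls_deriv w $$ (k - 1) \<noteq> 0" using w(1-3) by (simp_all add: vge_def)
  then have sw: "fls_subdegree (fls_deriv \<rho>) = k - 1" "fls_deriv \<rho> \<noteq> 0"
    unfolding d\<rho> by (rule subdegree_eq_vge, metis *(2) fls_zero_nth)
  have "P1 \<noteq> 0" using P1 by auto
  then obtain d1 where "fls_subdegree (hom_eval fls_const fls_X_inv P1) = -1 * int d1"
    "hom_eval fls_const fls_X_inv P1 \<noteq> 0" "(-1::int) < 0 \<longrightarrow> d1 = degree P1"
    by (rule hom_eval_fls_const_leading[OF z])
  then have d1: "fls_subdegree (hom_eval fls_const fls_X_inv P1) = - int (degree P1)"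
    "hom_eval fls_const fls_X_inv P1 \<noteq> 0" by auto
  have ot: "(of_int t :: 'a fls) \<noteq> 0" "fls_subdegree (of_int t :: 'a fls) = 0" using t by auto
  have L: "fls_subdegree (of_int t * fls_deriv \<rho> * hom_eval fls_const fls_X_inv P1) = k - 1 - int (degree P1)"
    using ot sw d1 by simp
  obtain d2 where d2: "fls_subdegree (hom_eval fls_const \<rho> P2) = k * int d2" "hom_eval fls_const \<rho> P2 \<noteq> 0"
      "k < 0 \<longrightarrow> d2 = degree (pcompose P2 [:c, 1:])"
    unfolding ev by (rule hom_eval_fls_const_leading[OF w(1-3) pc[OF P2]])
  have "fls_subdegree (- (fls_X_inv ^ 2) * hom_eval fls_const \<rho> P2) = -2 + k * int d2"
    using d2 by simp
  \<comment> \<open>For k = 1 this reads degree P1 + d2 = 2, against degree P1 \<ge> 3; for k = -1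
    it reads degree P1 = d2.\<close>
  with L ode' have "k - 1 - int (degree P1) = -2 + k * int d2" by simp
  then show ?thesis using k d2(3) P1 by (auto simp: degree_pcompose)
qed

text \<open>Write r = A/B in lowest terms. Clearing denominators leaves \<open>B ^ (d - 2)\<close>
  on the derivative side, so \<open>unit_of_dvd_form\<close> makes B constant. Then r is a
  polynomial S with t S' P1 = P2(S), and comparing degrees makes S linear.\<close>

lemma affine_of_residue_equation:
  fixes r :: "'a::field_char_0 poly fract"
  assumes nc: "\<And>c. r \<noteq> cx c"
    and ode: "of_int t * ddx r * to_fract P1 = hom_eval cx r P2"
    and deg: "degree P1 = degree P2" "degree P2 \<ge> 3"
  shows "\<exists>a b. a \<noteq> 0 \<and> pcompose P2 [:- b, a:] = smult (of_int t * a) P1"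
proof -
  define d where "d = degree P2"
  obtain U V where UV: "r = Fract U V" "V \<noteq> 0" by (cases r)
  obtain g A B u v where g: "g \<noteq> 0" "U = g * A" "V = g * B" and bez: "u * A + v * B = 1"
    using poly_bezout[of U V] UV(2) by blast
  have B: "B \<noteq> 0" using UV(2) g by auto
  have r: "r * to_fract B = to_fract A"
    unfolding UV(1) g(2,3) using g(1) B by (simp add: to_fract_def eq_fract)
  have dr: "ddx r * to_fract B ^ 2 = to_fract (pderiv A * B - A * pderiv B)"
  proof -
    have "ddx r * to_fract B + r * to_fract (pderiv B) = to_fract (pderiv A)"
      using arg_cong[OF r, of ddx] by (simp add: deriv_mult[OF is_deriv_ddx] ddx_to_fract)
    from arg_cong[OF this, of "\<lambda>x. x * to_fract B"]
    have "ddx r * to_fract B * to_fract B + (r * to_fract B) * to_fract (pderiv B) = to_fract (pderiv A) * to_fract B"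
      by (simp only: distrib_right distrib_left mult_ac)
    then show ?thesis unfolding r by (simp add: power2_eq_square algebra_simps)
  qed
  have hP: "hom_eval cx r P2 * to_fract B ^ d = to_fract (\<Sum>i\<le>d. smult (coeff P2 i) (A ^ i * B ^ (d - i)))"
  proof -
    have "hom_eval cx r P2 = (\<Sum>i\<le>d. cx (coeff P2 i) * r ^ i)"
      unfolding hom_eval_def poly_altdef d_def by (simp add: coeff_map_poly degree_map_poly)
    then have "hom_eval cx r P2 * to_fract B ^ d = (\<Sum>i\<le>d. cx (coeff P2 i) * r ^ i * to_fract B ^ d)"
      by (simp add: sum_distrib_right)
    also have "\<dots> = (\<Sum>i\<le>d. to_fract (smult (coeff P2 i) (A ^ i * B ^ (d - i))))"
    proof (rule sum.cong[OF refl])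
      fix i assume "i \<in> {..d}"
      then have e: "to_fract B ^ d = to_fract B ^ i * to_fract B ^ (d - i)" by (simp flip: power_add)
      have "cx (coeff P2 i) * r ^ i * to_fract B ^ d = cx (coeff P2 i) * ((r * to_fract B) ^ i * to_fract B ^ (d - i))"
        unfolding e by (simp add: power_mult_distrib)
      also have "\<dots> = to_fract ([:coeff P2 i:] * (A ^ i * B ^ (d - i)))"
        unfolding r by (simp only: hom_mult[OF hom_to_fract] hom_power[OF hom_to_fract])
      finally show "cx (coeff P2 i) * r ^ i * to_fract B ^ d = to_fract (smult (coeff P2 i) (A ^ i * B ^ (d - i)))"
        by simp
    qed
    finally show ?thesis by simp
  qed
  have "to_fract (of_int t * (pderiv A * B - A * pderiv B) * P1 * B ^ (d - 2)) =
      of_int t * (ddx r * to_fract B ^ 2) * to_fract P1 * to_fract B ^ (d - 2)"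
    unfolding dr by (simp only: hom_mult[OF hom_to_fract] hom_power[OF hom_to_fract] hom_of_int[OF hom_to_fract])
  also have "\<dots> = (of_int t * ddx r * to_fract P1) * to_fract B ^ (2 + (d - 2))"
    unfolding power_add by (simp add: mult_ac)
  also have "2 + (d - 2) = d" using deg by (simp add: d_def)
  finally have "to_fract (of_int t * (pderiv A * B - A * pderiv B) * P1 * B ^ (d - 2)) =
      to_fract (\<Sum>i\<le>d. smult (coeff P2 i) (A ^ i * B ^ (d - i)))"
    unfolding ode hP .
  then have eq: "(\<Sum>i\<le>d. smult (coeff P2 i) (A ^ i * B ^ (d - i))) =
      of_int t * (pderiv A * B - A * pderiv B) * P1 * B ^ (d - 2)"
    unfolding to_fract_eq_iff by (rule sym)
  have "coeff P2 d \<noteq> 0" using deg by (auto simp: d_def)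
  moreover have "B dvd B ^ (d - 2)" using deg by (intro dvd_power) (simp add: d_def)
  then have "B dvd (\<Sum>i\<le>d. smult (coeff P2 i) (A ^ i * B ^ (d - i)))" unfolding eq by simp
  ultimately have "B dvd 1" by (rule unit_of_dvd_form[OF bez, where h = "coeff P2"])
  then obtain c where c: "B = [:c:]" "c \<noteq> 0" by (metis is_unit_poly_iff dvd_0_left one_neq_zero)
  define S where "S = smult (inverse c) A"
  have "to_fract S * to_fract B = to_fract A"
    using c by (simp add: S_def flip: to_fract_mult)
  then have rS: "r = to_fract S" using r B by (metis mult_right_cancel to_fract_eq_0_iff)
  have "to_fract (of_int t * pderiv S * P1) = to_fract (pcompose P2 S)"
    using ode unfolding rS ddx_to_fract hom_eval_cx_to_fract
    by (simp only: hom_mult[OF hom_to_fract] hom_of_int[OF hom_to_fract])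
  then have eqS: "of_int t * pderiv S * P1 = pcompose P2 S" by (simp only: to_fract_eq_iff)
  have dS: "degree S \<noteq> 0" using nc rS by (metis degree_eq_zeroE)
  have "degree (pcompose P2 S) = d * degree S" by (simp add: degree_pcompose d_def)
  moreover have "pcompose P2 S \<noteq> 0" using calculation dS deg by (auto simp: d_def)
  ultimately have "degree (of_int t * pderiv S * P1) = d * degree S" "of_int t * pderiv S * P1 \<noteq> 0"
    unfolding eqS by auto
  then have "degree S - 1 + d = d * degree S"
    using deg by (simp add: degree_mult_eq degree_pderiv d_def)
  \<comment> \<open>The degree equation amounts to (d - 1)(degree S - 1) = 0; this bound excludes
    degree S \<ge> 2.\<close>
  moreover have "degree S \<ge> 2 \<Longrightarrow> d * degree S \<ge> degree S + 2 * d - 2"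
  proof -
    assume "degree S \<ge> 2"
    then obtain e where "degree S = 2 + e" using le_Suc_ex by blast
    moreover obtain d' where "d = 3 + d'" using deg le_Suc_ex unfolding d_def by blast
    ultimately show ?thesis by (simp add: algebra_simps)
  qed
  ultimately have "degree S = 1" using dS deg by (cases "degree S \<ge> 2") (auto simp: d_def)
  then obtain a b where ab: "S = [:b, a:]" "a \<noteq> 0" by (rule degree1_coeffs)
  have "of_int t * pderiv S * P1 = smult (of_int t * a) P1"
    by (simp add: ab pderiv_pCons of_int_poly mult.commute)
  then show ?thesis using ab eqS by (intro exI[of _ a] exI[of _ "- b"]) simp
qed

section \<open>The residue of the image of $x$\<close>

text \<open>Makes k(x) a coefficient field of characteristic zero for
  \<open>approximate_solution_is_root\<close>, whose flow argument divides by i!.\<close>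

instance fract :: ("{idom, ring_char_0}") field_char_0
proof
  show "inj (of_nat :: nat \<Rightarrow> 'a fract)"
    by (rule injI) (metis hom_of_nat[OF hom_to_fract] to_fract_eq_iff of_nat_eq_iff)
qed

lemma
  assumes v: "vge 0 \<xi>"
  shows vge_hom_eval_cst: "vge 0 (hom_eval cst \<xi> p)"
    and nth_hom_eval_cst: "hom_eval cst \<xi> p $$ 0 = hom_eval cx (\<xi> $$ 0) p"
proof -
  have "vge 0 (hom_eval cst \<xi> p) \<and> hom_eval cst \<xi> p $$ 0 = hom_eval cx (\<xi> $$ 0) p"
  proof (induction p)
    case (pCons a p)
    then have IH: "vge 0 (hom_eval cst \<xi> p)" by simp
    note m = vge_mult[OF v IH] nth_mult_vge[OF v IH]
    show ?case using pCons(2) m vge_add[OF vge_fls_const m(1)[simplified]]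
      by (simp add: hom_eval_pCons hom_cst hom_cx)
  qed simp
  then show "vge 0 (hom_eval cst \<xi> p)" "hom_eval cst \<xi> p $$ 0 = hom_eval cx (\<xi> $$ 0) p" by auto
qed

lemma to_fract_poly_sum:
  "to_fract p = (\<Sum>i\<le>degree p. cx (coeff p i) * to_fract [:0, 1:] ^ i)"
proof -
  have "to_fract p = hom_eval cx (to_fract [:0, 1:]) p"
    by (simp add: hom_eval_cx_to_fract)
  then show ?thesis
    by (simp add: hom_eval_def poly_altdef coeff_map_poly degree_map_poly)
qed

context poisson_embedding
begin

lemma eval_nonzero: "p \<noteq> 0 \<Longrightarrow> hom_eval cst \<xi> p \<noteq> 0"
  using nonzero[of "[:p:]"] by (simp add: hom_eval_pCons hom_hom_eval hom_cst)

lemma eta_nonzero: "\<eta> \<noteq> 0"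
  using nonzero[of "[:0, 1:]"]
  by (simp add: hom_eval_pCons[OF hom_hom_eval[OF hom_cst]] hom_1[OF hom_hom_eval[OF hom_cst]]
      hom_0[OF hom_hom_eval[OF hom_cst]])

text \<open>If \<xi> had valuation k < 0, then P2(\<xi>) \<eta> would have valuation at most 2 k +
  t, below the bound k + t for the bracket, where t is the valuation of \<eta>.\<close>

lemma vge_xi:
  assumes "degree P2 \<ge> 2"
  shows "vge 0 \<xi>"
proof (rule ccontr)
  assume *: "\<not> vge 0 \<xi>"
  define k where "k = fls_subdegree \<xi>"
  have "\<not> 0 \<le> k" using * vge_mono[OF vge_subdegree[of \<xi>]] by (auto simp: k_def)
  then have k: "k < 0" by simp
  have \<xi>: "\<xi> \<noteq> 0" using * by auto
  have "P2 \<noteq> 0" using assms by auto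
  define t where "t = fls_subdegree \<eta>"
  have v: "vge k \<xi>" "vge t \<eta>" "\<xi> $$ k \<noteq> 0" "\<eta> $$ t \<noteq> 0"
    using \<xi> eta_nonzero by (simp_all add: k_def t_def vge_subdegree)
  obtain j where j: "coeff P2 j \<noteq> 0" "vge (k * int j) (hom_eval cst \<xi> P2)"
    "hom_eval cst \<xi> P2 $$ (k * int j) = cst (coeff P2 j) $$ 0 * (\<xi> $$ k) ^ j" "k < 0 \<longrightarrow> j = degree P2"
    by (rule hom_eval_leading[OF hom_cst vge_fls_const _ v(1) \<open>P2 \<noteq> 0\<close>]) (use k in auto)
  have "(hom_eval cst \<xi> P2 * \<eta>) $$ (k * int j + t) \<noteq> 0"
    unfolding nth_mult_vge[OF j(2) v(2)] j(3) using j(1) v by simp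
  moreover have "k * int j \<le> k * 2" using j(4) k assms by (intro mult_left_mono_neg) auto
  then have "k * int j + t < k + t" using k by simp
  then have "fls_bracket P1 \<xi> \<eta> $$ (k * int j + t) = 0"
    using vge_fls_bracket[OF v(1,2), of P1] by (simp add: vge_def)
  ultimately show False using bracket by simp
qed

text \<open>For a constant residue, a multiple D of {\<xi>, -} annihilates k[\<xi>], scales \<eta>
  by a constant of D and does not lower the valuation. It sends x to a nonzero multiple of P1(x)
  modulo positive valuation, so \<open>approximate_solution_is_root\<close> applies to x.\<close>

lemma residue_not_const:
  assumes v\<xi>: "vge 0 \<xi>" and P1: "degree P1 \<ge> 3" and P2: "P2 \<noteq> 0"
  shows "\<xi> $$ 0 \<noteq> cx \<alpha>"
proof
  assume \<alpha>: "\<xi> $$ 0 = cx \<alpha>"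
  define \<zeta> where "\<zeta> = \<xi> - cst \<alpha>"
  have \<zeta>_eval: "\<zeta> = hom_eval cst \<xi> [:- \<alpha>, 1:]"
    unfolding \<zeta>_def hom_eval_pCons[OF hom_cst] hom_eval_0 hom_minus[OF hom_cst] hom_1[OF hom_cst]
    by simp
  have \<zeta>0: "\<zeta> \<noteq> 0" unfolding \<zeta>_eval by (rule eval_nonzero) simp
  define s where "s = fls_subdegree \<zeta>"
  define a where "a = \<zeta> $$ s"
  have a: "a \<noteq> 0" "vge s \<zeta>" using \<zeta>0 by (simp_all add: a_def s_def vge_subdegree)
  have "vge 0 \<zeta>" unfolding \<zeta>_def by (rule vge_diff[OF v\<xi> vge_fls_const])
  moreover have "\<zeta> $$ 0 = 0" by (simp add: \<zeta>_def \<alpha>)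
  ultimately have "vge 1 \<zeta>"
    unfolding vge_def by (metis int_one_le_iff_zero_less linorder_cases not_le)
  then have s: "s \<ge> 1" using vge_le_subdegree \<zeta>0 by (auto simp: s_def)
  define t where "t = fls_subdegree \<eta>"
  have t: "vge t \<eta>" "\<eta> $$ t \<noteq> 0" using eta_nonzero by (simp_all add: t_def vge_subdegree)
  obtain Q where Q: "P2 = [:- \<alpha>, 1:] ^ order \<alpha> P2 * Q" "\<not> [:- \<alpha>, 1:] dvd Q"
    using order_decomp[OF P2] by blast
  define m where "m = order \<alpha> P2"
  define q where "q = poly Q \<alpha>"
  have q: "q \<noteq> 0" using Q(2) by (simp add: q_def poly_eq_0_iff_dvd)
  define R where "R = hom_eval cst \<xi> Q"
  have R: "vge 0 R" "R $$ 0 = cx q"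
    unfolding R_def using vge_hom_eval_cst[OF v\<xi>] nth_hom_eval_cst[OF v\<xi>]
    by (simp_all add: \<alpha> hom_eval_cx_to_fract pcompose_pCons_0 q_def)
  have eP2: "hom_eval cst \<xi> P2 = \<zeta> ^ m * R"
    unfolding R_def \<zeta>_eval m_def hom_power[OF hom_hom_eval[OF hom_cst], symmetric]
      hom_mult[OF hom_hom_eval[OF hom_cst], symmetric] by (subst Q(1)) simp
  have br: "fls_bracket P1 \<zeta> f = fls_bracket P1 \<xi> f" for f
    unfolding \<zeta>_def fls_bracket_swap[of P1 "\<xi> - cst \<alpha>" f] fls_bracket_swap[of P1 \<xi> f]
    by (simp add: deriv_diff[OF is_deriv_fls_bracket] fls_bracket_const)
  \<comment> \<open>If P2(\<alpha>) were nonzero, {\<zeta>, \<eta>} = R \<eta> would have valuation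
    t, but \<zeta> has positive valuation and the bracket adds valuations.\<close>
  have m: "m \<ge> 1"
  proof (rule ccontr)
    assume "\<not> m \<ge> 1"
    then have "m = 0" by simp
    then have "fls_bracket P1 \<zeta> \<eta> = R * \<eta>" using br bracket eP2 by simp
    moreover have "fls_bracket P1 \<zeta> \<eta> $$ (0 + t) = 0"
      using vge_fls_bracket[OF a(2) t(1), of P1] s by (simp add: vge_def)
    moreover have "(R * \<eta>) $$ (0 + t) \<noteq> 0" unfolding nth_mult_vge[OF R(1) t(1)] using t R q by simp
    ultimately show False by simp
  qed
  have \<zeta>R: "vge (s + 0) (\<zeta> * R)" "(\<zeta> * R) $$ (s + 0) = a * cx q"
    using vge_mult[OF a(2) R(1)] nth_mult_vge[OF a(2) R(1)] R(2) by (simp_all add: a_def)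
  then have "(\<zeta> * R) $$ (s + 0) \<noteq> 0" using a q by simp
  note iR = vge_inverse[OF \<zeta>R(1) this] nth_inverse_vge[OF \<zeta>R(1) this]
  \<comment> \<open>Bracketing with \<zeta> raises the valuation by at least s and dividing by
    \<zeta> R lowers it by s. From {\<xi>, \<eta>} = \<zeta>^m R \<eta> it follows that D \<eta> =
    \<zeta>^(m - 1) \<eta>.\<close>
  define D where "D f = inverse (\<zeta> * R) * fls_bracket P1 \<xi> f" for f
  define z where "z = \<zeta> ^ (m - 1)"
  have D: "is_deriv D"
    by (rule is_derivI) (simp_all add: D_def deriv_add[OF is_deriv_fls_bracket] deriv_mult[OF is_deriv_fls_bracket] algebra_simps)
  have Dv: "vge n (D f)" if "vge n f" for n f
    using vge_mult[OF iR(1) vge_fls_bracket[OF a(2) that, of P1]] unfolding D_def br[symmetric] by simp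
  have Dp: "D (hom_eval cst \<xi> p) = 0" for p
    by (simp add: D_def fls_bracket_poly fls_bracket_self)
  have Dc: "D (cst c) = 0" for c by (simp add: D_def fls_bracket_const)
  have z: "D z = 0" "vge 0 z"
  proof -
    have e: "z = hom_eval cst \<xi> ([:- \<alpha>, 1:] ^ (m - 1))"
      unfolding z_def \<zeta>_eval hom_power[OF hom_hom_eval[OF hom_cst]] ..
    show "D z = 0" "vge 0 z" unfolding e by (rule Dp, rule vge_hom_eval_cst[OF v\<xi>])
  qed
  have Dy: "D \<eta> = z * \<eta>"
  proof -
    have "\<zeta> ^ m = \<zeta> * z" using m by (cases m) (simp_all add: z_def)
    moreover have "R \<noteq> 0" using R(2) q by auto
    ultimately show ?thesis using \<zeta>0 by (simp add: D_def bracket eP2 field_simps)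
  qed
  define X where "X = rat_of_poly [:0, 1 :: 'a:]"
  have X: "vge 0 X" "X $$ 0 = to_fract [:0, 1:]" by (simp_all add: X_def vge_fls_const)
  obtain F G where FG: "G \<noteq> 0" "hom_eval (hom_eval cst \<xi>) \<eta> F = X * hom_eval (hom_eval cst \<xi>) \<eta> G"
    using generate_x by (auto simp: X_def)
  \<comment> \<open>The leading coefficient of {\<zeta>, x} is -s a P1, and that of \<zeta> R is a
    q; their quotient is c P1.\<close>
  define c where "c = - of_int s / q"
  define h where "h i = cx (c * coeff P1 i)" for i
  have k: "kills_coeffs D (map_poly (hom_eval cst \<xi>) p)" for p
    by (simp add: kills_coeffs_def coeff_map_poly Dp)
  have "D X $$ (- (s + 0) + (s + 0)) = inverse (a * cx q) * ((of_int 0 * ddx (\<zeta> $$ s) * X $$ 0 - of_int s * \<zeta> $$ s * ddx (X $$ 0)) * to_fract P1)"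
    unfolding D_def br[symmetric] nth_mult_vge[OF iR(1) vge_fls_bracket[OF a(2) X(1)]]
      nth_fls_bracket[OF a(2) X(1)] iR(2) \<zeta>R(2) ..
  also have "ddx (X $$ 0) = 1" by (simp add: X ddx_to_fract pderiv_pCons flip: one_pCons)
  finally have DX0: "D X $$ 0 = - of_int s / cx q * to_fract P1"
    using a(1) q by (simp add: a_def[symmetric] field_simps)
  have cc: "- of_int s / cx q = cx c"
  proof -
    have "cx c * cx q = - of_int s"
      using q by (simp add: c_def hom_of_int[OF hom_cx, symmetric] flip: to_fract_mult to_fract_uminus)
    then show ?thesis using q by (simp add: field_simps)
  qed
  have sum: "(\<Sum>i\<le>degree P1. h i * to_fract [:0, 1:] ^ i) = cx c * to_fract P1"
    unfolding to_fract_poly_sum[of P1] sum_distrib_left h_def hom_mult[OF hom_cx] by (simp add: mult.assoc)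
  have sumX: "(\<Sum>i\<le>degree P1. fls_const (h i) * X ^ i) = fls_const (cx c * to_fract P1)"
    unfolding sum[symmetric] X_def by (simp add: hom_sum[OF hom_fls_const] hom_power[OF hom_fls_const] hom_mult[OF hom_fls_const])
  have "vge 0 (D X - fls_const (cx c * to_fract P1))"
    by (rule vge_diff[OF Dv[OF X(1)] vge_fls_const])
  moreover have "(D X - fls_const (cx c * to_fract P1)) $$ 0 = 0"
    unfolding fls_minus_nth DX0 cc by simp
  ultimately have DX: "vge 1 (D X - (\<Sum>i\<le>degree P1. fls_const (h i) * X ^ i))"
    unfolding sumX vge_def by (metis int_one_le_iff_zero_less linorder_cases not_le)
  have c0: "c \<noteq> 0" using s q by (simp add: c_def)
  \<comment> \<open>The residue of X is x itself, so being a root means c P1 = 0 in k(x).\<close>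
  have "(\<Sum>i\<le>degree P1. h i * (X $$ 0) ^ i) = 0"
  proof (rule approximate_solution_is_root[OF D Dv z Dy k k _ _ X(1) P1 _ _ DX])
    show "poly (map_poly (hom_eval cst \<xi>) G) \<eta> \<noteq> 0"
      using nonzero[OF FG(1)] by (simp add: hom_eval_def)
    show "poly (map_poly (hom_eval cst \<xi>) F) \<eta> = X * poly (map_poly (hom_eval cst \<xi>) G) \<eta>"
      using FG(2) by (simp add: hom_eval_def)
    show "h (degree P1) \<noteq> 0" using c0 P1 by (auto simp: h_def)
    show "D (fls_const u) = 0" if "u \<in> range h" for u using that Dc by (auto simp: h_def)
  qed
  then have "cx c * to_fract P1 = 0" unfolding X(2) sum .
  then show False using c0 P1 by auto
qed

text \<open>The differential equation compares leading coefficients in the bracket relation. As the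
  residue is transcendental, valuations of polynomials in \<xi> and \<eta> are multiples of t;
  expressing y gives t = 1 or t = -1, and expressing x puts x into k(r).\<close>

lemma residue_equation:
  assumes v\<xi>: "vge 0 \<xi>" and nc: "\<And>\<alpha>. \<xi> $$ 0 \<noteq> cx \<alpha>" and P2: "P2 \<noteq> 0"
  obtains t f g where "t = 1 \<or> t = (-1::int)"
    "of_int t * ddx (\<xi> $$ 0) * to_fract P1 = hom_eval cx (\<xi> $$ 0) P2"
    "g \<noteq> 0" "hom_eval cx (\<xi> $$ 0) f = to_fract [:0, 1:] * hom_eval cx (\<xi> $$ 0) g"
proof -
  define r where "r = \<xi> $$ 0"
  define t where "t = fls_subdegree \<eta>"
  have tr: "hom_eval cx r p \<noteq> 0" if "p \<noteq> 0" for p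
    using nonconst_transcendental[OF _ that, of r] nc by (simp add: r_def)
  have t: "vge t \<eta>" "\<eta> $$ t \<noteq> 0" using eta_nonzero by (simp_all add: t_def vge_subdegree)
  have "(of_int t * ddx r * \<eta> $$ t) * to_fract P1 = hom_eval cx r P2 * \<eta> $$ t"
    using nth_fls_bracket[OF v\<xi> t(1), of P1] nth_mult_vge[OF vge_hom_eval_cst[OF v\<xi>] t(1), of P2]
    unfolding bracket nth_hom_eval_cst[OF v\<xi>] r_def by simp
  then have "(of_int t * ddx r * to_fract P1) * \<eta> $$ t = hom_eval cx r P2 * \<eta> $$ t"
    by (simp only: mult_ac)
  then have ode: "of_int t * ddx r * to_fract P1 = hom_eval cx r P2" using t(2) by simp
  then have t0: "t \<noteq> 0" using tr[OF P2] by auto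
  have nz: "hom_eval cst \<xi> p $$ 0 \<noteq> 0" if "p \<noteq> 0" for p
    unfolding nth_hom_eval_cst[OF v\<xi>] using tr[OF that] by (simp add: r_def)
  \<comment> \<open>Nonzero polynomials in \<xi> have valuation 0, so different powers of \<eta>
    cannot cancel.\<close>
  have lead: "\<exists>j. coeff F j \<noteq> 0 \<and> vge (t * int j) (hom_eval (hom_eval cst \<xi>) \<eta> F) \<and>
      hom_eval (hom_eval cst \<xi>) \<eta> F $$ (t * int j) = hom_eval cx r (coeff F j) * (\<eta> $$ t) ^ j \<and>
      fls_subdegree (hom_eval (hom_eval cst \<xi>) \<eta> F) = t * int j" if F: "F \<noteq> 0" for F
  proof -
    obtain j where j: "coeff F j \<noteq> 0" "vge (t * int j) (hom_eval (hom_eval cst \<xi>) \<eta> F)"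
      "hom_eval (hom_eval cst \<xi>) \<eta> F $$ (t * int j) = hom_eval cst \<xi> (coeff F j) $$ 0 * (\<eta> $$ t) ^ j"
      by (rule hom_eval_leading[OF hom_hom_eval[OF hom_cst] vge_hom_eval_cst[OF v\<xi>] nz t(1) F t0]) blast+
    have "hom_eval (hom_eval cst \<xi>) \<eta> F $$ (t * int j) \<noteq> 0"
      unfolding j(3) using nz[OF j(1)] t(2) by simp
    then show ?thesis using j subdegree_eq_vge nth_hom_eval_cst[OF v\<xi>] by (metis r_def)
  qed
  obtain F G where FG: "G \<noteq> 0" "hom_eval (hom_eval cst \<xi>) \<eta> F = fls_X * hom_eval (hom_eval cst \<xi>) \<eta> G"
    using generate_y by blast
  have "F \<noteq> 0" using FG nonzero[OF FG(1)] by auto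
  obtain i j where "fls_subdegree (hom_eval (hom_eval cst \<xi>) \<eta> F) = t * int i"
    "fls_subdegree (hom_eval (hom_eval cst \<xi>) \<eta> G) = t * int j"
    using lead[OF \<open>F \<noteq> 0\<close>] lead[OF FG(1)] by blast
  \<comment> \<open>The 1 is the valuation of y, a quotient of two elements with valuations in t
    Z.\<close>
  then have "t * int i = 1 + t * int j" using FG(2) nonzero[OF FG(1)] by simp
  then have "t * (int i - int j) = 1" by (simp add: algebra_simps)
  then have t1: "t = 1 \<or> t = -1" by (metis zmult_eq_1_iff)
  obtain F G where FG: "G \<noteq> 0"
    "hom_eval (hom_eval cst \<xi>) \<eta> F = rat_of_poly [:0, 1:] * hom_eval (hom_eval cst \<xi>) \<eta> G"
    using generate_x by blast
  have "F \<noteq> 0" using FG nonzero[OF FG(1)] by auto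
  obtain i where i: "coeff F i \<noteq> 0"
      "hom_eval (hom_eval cst \<xi>) \<eta> F $$ (t * int i) = hom_eval cx r (coeff F i) * (\<eta> $$ t) ^ i"
      "fls_subdegree (hom_eval (hom_eval cst \<xi>) \<eta> F) = t * int i"
    using lead[OF \<open>F \<noteq> 0\<close>] by blast
  obtain j where j: "coeff G j \<noteq> 0"
      "hom_eval (hom_eval cst \<xi>) \<eta> G $$ (t * int j) = hom_eval cx r (coeff G j) * (\<eta> $$ t) ^ j"
      "fls_subdegree (hom_eval (hom_eval cst \<xi>) \<eta> G) = t * int j"
    using lead[OF FG(1)] by blast
  \<comment> \<open>Since x has valuation 0, both leading indices agree; the power of \<eta> then
    cancels and x becomes a quotient of polynomials in r.\<close>
  have "t * int i = t * int j" using i(3) j(3) FG(2) nonzero[OF FG(1)] by auto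
  then have "i = j" using t0 by simp
  have "hom_eval (hom_eval cst \<xi>) \<eta> F $$ (t * int i) = to_fract [:0, 1:] * hom_eval (hom_eval cst \<xi>) \<eta> G $$ (t * int i)"
    unfolding FG(2) by simp
  then have "hom_eval cx r (coeff F i) * (\<eta> $$ t) ^ i = (to_fract [:0, 1:] * hom_eval cx r (coeff G i)) * (\<eta> $$ t) ^ i"
    using i(2) j(2) unfolding \<open>i = j\<close> by (simp only: mult.assoc)
  then have "hom_eval cx r (coeff F i) = to_fract [:0, 1:] * hom_eval cx r (coeff G i)"
    using t(2) by simp
  then show ?thesis using that[OF t1] ode j(1) \<open>i = j\<close> unfolding r_def by blast
qed

lemma degree_ge_3_affine:
  assumes "degree P1 \<ge> 3" "degree P2 \<ge> 2"
  shows "degree P1 = degree P2 \<and>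
    (\<exists>a b t. a \<noteq> 0 \<and> (t = 1 \<or> t = -1) \<and> pcompose P2 [:- b, a:] = smult (t * a) P1)"
proof -
  have P2: "P2 \<noteq> 0" using assms by auto
  have v: "vge 0 \<xi>" using assms by (intro vge_xi)
  note nc = residue_not_const[OF v assms(1) P2]
  obtain t f g where *: "t = 1 \<or> t = (-1::int)"
    "of_int t * ddx (\<xi> $$ 0) * to_fract P1 = hom_eval cx (\<xi> $$ 0) P2"
    "g \<noteq> 0" "hom_eval cx (\<xi> $$ 0) f = to_fract [:0, 1:] * hom_eval cx (\<xi> $$ 0) g"
    by (rule residue_equation[OF v nc P2]) blast
  have d: "degree P1 = degree P2"
    by (rule degree_eq_of_residue_equation[OF nc _ *(2,4,3) assms(1) P2]) (use *(1) in auto)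
  obtain a b where "a \<noteq> 0" "pcompose P2 [:- b, a:] = smult (of_int t * a) P1"
    using affine_of_residue_equation[OF nc *(2) d] d assms by auto
  then show ?thesis using d *(1) by (intro conjI exI[of _ a] exI[of _ b] exI[of _ "of_int t"]) auto
qed

end

section \<open>The case of quadratic polynomials\<close>

text \<open>With \<beta> the second root of P2, the quotient h = \<xi>/(\<xi> - \<beta>) linearises
  the relation to {h, \<eta>} = e2 h \<eta>. Leading coefficients a, b in y give (t a' b - s a b')
  P1 = e2 a b; if a and b have orders i and j at x = 0, this yields (t i - s j) e1 = e2.\<close>

lemma (in poisson_embedding) quadratic_integer_multiple:
  assumes P1: "P1 = [:0, e1, c1:]" and P2: "P2 = [:0, e2, c2:]" and c2: "c2 \<noteq> 0" and e2: "e2 \<noteq> 0"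
  shows "\<exists>n::int. e2 = of_int n * e1"
proof -
  define \<beta> where "\<beta> = - e2 / c2"
  define den where "den = hom_eval cst \<xi> [:- \<beta>, 1:]"
  have den: "den \<noteq> 0" unfolding den_def by (rule eval_nonzero) simp
  have den_eq: "den = \<xi> - cst \<beta>"
    unfolding den_def hom_eval_pCons[OF hom_cst] hom_eval_0 hom_minus[OF hom_cst] hom_1[OF hom_cst] by simp
  have \<xi>0: "\<xi> \<noteq> 0" using eval_nonzero[of "[:0, 1:]"]
    unfolding hom_eval_pCons[OF hom_cst] hom_eval_0 hom_0[OF hom_cst] hom_1[OF hom_cst] by simp
  define h where "h = \<xi> / den"
  have h0: "h \<noteq> 0" using \<xi>0 den by (simp add: h_def)
  have ce: "cst e2 = - cst \<beta> * cst c2"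
  proof -
    have "e2 = - \<beta> * c2" using c2 by (simp add: \<beta>_def)
    then have "cst e2 = cst (- \<beta>) * cst c2" by (metis hom_mult[OF hom_cst])
    then show ?thesis by (simp only: hom_minus[OF hom_cst])
  qed
  have eP2: "hom_eval cst \<xi> P2 = cst c2 * \<xi> * den"
    unfolding P2 hom_eval_pCons[OF hom_cst] hom_eval_0 hom_0[OF hom_cst] ce den_eq by (simp add: algebra_simps)
  \<comment> \<open>\<eta> takes the first slot because \<open>is_deriv_fls_bracket\<close> concerns
    the second; \<open>fls_bracket_swap\<close> restores the sign.\<close>
  define D where "D = fls_bracket P1 \<eta>"
  have D: "is_deriv D" unfolding D_def by (rule is_deriv_fls_bracket)
  have D\<xi>: "D \<xi> = - (cst c2 * \<xi> * den * \<eta>)"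
    unfolding D_def fls_bracket_swap[of P1 \<eta> \<xi>] bracket eP2 ..
  have Dden: "D den = D \<xi>" unfolding den_eq deriv_diff[OF D] by (simp add: D_def fls_bracket_const)
  have "D \<xi> = D h * den + h * D \<xi>"
    using deriv_mult[OF D, of h den] den unfolding Dden by (simp add: h_def)
  then have "D h * den = D \<xi> - h * D \<xi>" by (metis add_diff_cancel_right')
  then have "D h * den * den = (D \<xi> - h * D \<xi>) * den" by simp
  also have "\<dots> = (den - h * den) * D \<xi>" by (simp add: algebra_simps)
  also have "den - h * den = - cst \<beta>" using den by (simp add: h_def den_eq)
  also have "- cst \<beta> * D \<xi> = - (cst e2 * h * \<eta>) * den * den"
    unfolding D\<xi> ce using den by (simp add: h_def)
  finally have Dh: "D h = - (cst e2 * h * \<eta>)" using mult_right_cancel[OF den] by blast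
  then have br: "fls_bracket P1 h \<eta> = cst e2 * h * \<eta>"
    unfolding D_def fls_bracket_swap[of P1 \<eta> h] by simp
  define s where "s = fls_subdegree h"
  define t where "t = fls_subdegree \<eta>"
  define a where "a = h $$ s"
  define b where "b = \<eta> $$ t"
  have v: "vge s h" "vge t \<eta>" and ab: "a \<noteq> 0" "b \<noteq> 0"
    using h0 eta_nonzero by (simp_all add: s_def t_def a_def b_def vge_subdegree)
  have "(cst e2 * h * \<eta>) $$ (0 + s + t) = cx e2 * a * b"
    unfolding nth_mult_vge[OF vge_mult[OF vge_fls_const v(1)] v(2)] nth_mult_vge[OF vge_fls_const v(1)]
    by (simp add: a_def b_def)
  then have res: "(of_int t * ddx a * b - of_int s * a * ddx b) * to_fract P1 = cx e2 * a * b"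
    using nth_fls_bracket[OF v, of P1] br by (simp add: a_def b_def)
  \<comment> \<open>The second expansion: the coefficients a, b in k(x) are expanded at x = 0, a
    root of P1.\<close>
  have z: "vge 1 (fls_X :: 'a fls)" "fls_X $$ 1 \<noteq> (0::'a)" "(1::int) \<noteq> 0"
    by (simp_all add: vge_fls_X)
  note E = hom_expand[OF z]
  define A where "A = expand fls_X a"
  define B where "B = expand fls_X b"
  have AB0: "A \<noteq> 0" "B \<noteq> 0" using ab hom_eq_0_iff[OF E] by (simp_all add: A_def B_def)
  \<comment> \<open>P1 = x U with U(0) = e1. The split-off x turns each derivative into x d/dx,
    which multiplies a coefficient by its index.\<close>
  define U where "U = fls_const e1 + fls_X * fls_const c1"
  have U: "vge 0 U" "U $$ 0 = e1"
    by (auto simp: U_def vge_def fls_X_times_conv_shift)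
  have "expand fls_X (to_fract P1) = fls_X * U"
    unfolding expand_to_fract[OF z] P1 hom_eval_pCons[OF hom_fls_const] by (simp add: U_def)
  moreover have "expand fls_X (ddx q) = fls_deriv (expand fls_X q)" for q :: "'a poly fract"
    by (simp add: expand_ddx[OF z])
  ultimately have "(of_int t * fls_deriv A * B - of_int s * A * fls_deriv B) * (fls_X * U) = fls_const e2 * A * B"
    using arg_cong[OF res, of "expand fls_X"]
    by (simp only: hom_mult[OF E] hom_diff[OF E] hom_of_int[OF E] expand_cx[OF z] A_def B_def)
  then have eq: "(of_int t * ((fls_X * fls_deriv A) * B) - of_int s * (A * (fls_X * fls_deriv B))) * U = fls_const e2 * A * B"
    by (simp add: algebra_simps)
  define i where "i = fls_subdegree A"
  define j where "j = fls_subdegree B"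
  have vA: "vge i A" "vge i (fls_X * fls_deriv A)" "(fls_X * fls_deriv A) $$ i = of_int i * A $$ i"
    and vB: "vge j B" "vge j (fls_X * fls_deriv B)" "(fls_X * fls_deriv B) $$ j = of_int j * B $$ j"
    by (simp_all add: i_def j_def vge_def fls_X_times_conv_shift)
  have oi: "(of_int n * f) $$ m = of_int n * f $$ m" for n m and f :: "'a fls"
    by (simp add: fls_of_int)
  have vD: "vge (i + j) (of_int t * ((fls_X * fls_deriv A) * B) - of_int s * (A * (fls_X * fls_deriv B)))"
    using vge_mult[OF vA(2) vB(1)] vge_mult[OF vA(1) vB(2)] by (simp add: vge_def oi)
  have "((of_int t * ((fls_X * fls_deriv A) * B) - of_int s * (A * (fls_X * fls_deriv B))) * U) $$ (i + j + 0) =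
      (of_int t * (of_int i * A $$ i * B $$ j) - of_int s * (A $$ i * (of_int j * B $$ j))) * e1"
    unfolding nth_mult_vge[OF vD U(1)] U(2) fls_minus_nth oi nth_mult_vge[OF vA(2) vB(1)]
      nth_mult_vge[OF vA(1) vB(2)] vA(3) vB(3) ..
  also have "\<dots> = of_int (t * i - s * j) * e1 * (A $$ i * B $$ j)"
    by (simp add: algebra_simps)
  finally have "of_int (t * i - s * j) * e1 * (A $$ i * B $$ j) = (fls_const e2 * A * B) $$ (0 + i + j)"
    unfolding eq by simp
  also have "\<dots> = e2 * (A $$ i * B $$ j)"
    unfolding nth_mult_vge[OF vge_mult[OF vge_fls_const vA(1)] vB(1)] nth_mult_vge[OF vge_fls_const vA(1)] by simp
  finally have "of_int (t * i - s * j) * e1 * (A $$ i * B $$ j) = e2 * (A $$ i * B $$ j)" .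
  moreover have "A $$ i * B $$ j \<noteq> 0" using AB0 by (simp add: i_def j_def)
  ultimately have "e2 = of_int (t * i - s * j) * e1" by (metis mult_right_cancel)
  then show ?thesis by blast
qed

section \<open>Affine substitutions\<close>

text \<open>Induction over the field generated by constants, x and y: first polynomials in x, then
  in y, then fractions. It serves both the vanishing of derivations and surjectivity.\<close>

lemma rf_generated:
  assumes const: "\<And>c. P (rf_const c)" and X: "P rf_X" and Y: "P rf_Y"
    and add: "\<And>u v. P u \<Longrightarrow> P v \<Longrightarrow> P (u + v)" and mult: "\<And>u v. P u \<Longrightarrow> P v \<Longrightarrow> P (u * v)"
    and inv: "\<And>u. P u \<Longrightarrow> P (inverse u)"
  shows "P q"
proof -
  have 0: "P 0" using const[of 0] by (simp add: rf_const_conv)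
  have px: "P (to_fract [:p:])" for p
  proof (induction p)
    case (pCons a p)
    have "[:pCons a p:] = [:[:a:]:] + [:[:0, 1:]:] * [:p:]" by simp
    then have "to_fract [:pCons a p:] = rf_const a + rf_X * to_fract [:p:]"
      by (simp only: to_fract_add to_fract_mult rf_const_conv rf_X_conv)
    then show ?case using const X pCons add mult by simp
  qed (use 0 in simp)
  have "P (to_fract F)" for F
  proof (induction F)
    case (pCons a F)
    have "pCons a F = [:a:] + [:0, 1:] * F" by simp
    then have "to_fract (pCons a F) = to_fract [:a:] + rf_Y * to_fract F"
      by (simp only: to_fract_add to_fract_mult rf_Y_conv)
    then show ?case using px Y pCons add mult by simp
  qed (use 0 in simp)
  then show ?thesis
    by (cases q) (simp add: Fract_conv_to_fract divide_inverse mult inv)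
qed

lemma is_deriv_rf_dx: "is_deriv rf_dx"
  unfolding rf_dx_def by (rule is_deriv_fract_deriv[OF is_deriv_map_poly_pderiv])

lemma is_deriv_rf_dy: "is_deriv rf_dy"
  unfolding rf_dy_def by (rule is_deriv_fract_deriv[OF is_deriv_pderiv])

lemma is_deriv_rf_bracket: "is_deriv (rf_bracket f g)"
  by (rule is_derivI)
    (simp_all add: rf_bracket_def deriv_add[OF is_deriv_rf_dx] deriv_add[OF is_deriv_rf_dy]
      deriv_mult[OF is_deriv_rf_dx] deriv_mult[OF is_deriv_rf_dy] algebra_simps)

lemma rf_bracket_swap: "rf_bracket f h g = - rf_bracket f g h"
  by (simp add: rf_bracket_def algebra_simps)

lemma rf_bracket_self: "rf_bracket f g g = 0"
  by (simp add: rf_bracket_def algebra_simps)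

lemma rf_bracket_const: "rf_bracket f g (rf_const c) = 0"
proof -
  have "rf_dx (rf_const c) = 0" "rf_dy (rf_const c) = 0"
    unfolding rf_const_conv rf_dx_def rf_dy_def fract_deriv_to_fract[OF is_deriv_map_poly_pderiv]
      fract_deriv_to_fract[OF is_deriv_pderiv]
    by (simp_all add: map_poly_pCons pderiv_pCons)
  then show ?thesis by (simp add: rf_bracket_def)
qed

text \<open>The zeros of a derivation along \<phi> form a subfield, and this one contains generators
  of k(x,y).\<close>

lemma derivation_along_hom_zero:
  fixes T \<phi> :: "'a::field_char_0 ratfun2 \<Rightarrow> 'a ratfun2"
  assumes \<phi>: "is_hom \<phi>" and add: "\<And>u v. T (u + v) = T u + T v"
    and mult: "\<And>u v. T (u * v) = T u * \<phi> v + \<phi> u * T v"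
    and "\<And>c. T (rf_const c) = 0" "T rf_X = 0" "T rf_Y = 0"
  shows "T q = 0"
proof (rule rf_generated[where P = "\<lambda>q. T q = 0"])
  fix u assume u: "T u = 0"
  have T1: "T 1 = 0" using mult[of 1 1] by (simp add: hom_1[OF \<phi>])
  show "T (inverse u) = 0"
  proof (cases "u = 0")
    case False
    then have "\<phi> u * T (inverse u) = 0" using mult[of u "inverse u"] u T1 by simp
    then show ?thesis using False hom_eq_0_iff[OF \<phi>] by simp
  qed (use u in simp)
qed (simp_all add: assms)

text \<open>The defect \<open>T\<close> of bracket preservation is antisymmetric and a derivation
  along \<phi> in each argument, so it vanishes once it does so on the pair x, y. Injectivity is
  automatic for fields.\<close>

lemma poisson_isoI:
  assumes \<phi>: "is_hom \<phi>" and c: "\<And>c. \<phi> (rf_const c) = rf_const c" and surj: "surj \<phi>"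
    and br: "rf_bracket f2 (\<phi> rf_X) (\<phi> rf_Y) = \<phi> f1"
  shows "poisson_iso f1 f2 \<phi>"
proof -
  have "inj \<phi>"
  proof (rule injI)
    fix u v assume "\<phi> u = \<phi> v"
    then have "\<phi> (u - v) = 0" by (simp add: hom_diff[OF \<phi>])
    then show "u = v" using hom_eq_0_iff[OF \<phi>] by simp
  qed
  define T where "T g h = \<phi> (rf_bracket f1 g h) - rf_bracket f2 (\<phi> g) (\<phi> h)" for g h
  note bd = is_deriv_rf_bracket
  have T: "T g (u + v) = T g u + T g v" "T g (u * v) = T g u * \<phi> v + \<phi> u * T g v" "T g (rf_const c) = 0"
    "T g h = - T h g" for g h u v c
    unfolding T_def rf_bracket_swap[of f1 g h] rf_bracket_swap[of f2 "\<phi> g" "\<phi> h"]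
    by (simp_all add: hom_add[OF \<phi>] hom_mult[OF \<phi>] hom_0[OF \<phi>] hom_minus[OF \<phi>] deriv_add[OF bd] deriv_mult[OF bd]
        rf_bracket_const c algebra_simps)
  have self: "T g g = 0" for g by (simp add: T_def rf_bracket_self hom_0[OF \<phi>])
  have XY: "T rf_X rf_Y = 0" by (simp add: T_def rf_bracket_X_Y br)
  have YX: "T rf_Y rf_X = 0" using T(4)[of rf_Y rf_X] XY by simp
  have X: "T rf_X h = 0" for h
    by (rule derivation_along_hom_zero[OF \<phi>]) (simp_all add: T(1-3) self XY)
  have Y: "T rf_Y h = 0" for h
    by (rule derivation_along_hom_zero[OF \<phi>]) (simp_all add: T(1-3) self YX)
  have "T g h = 0" for g h
    by (rule derivation_along_hom_zero[OF \<phi>]) (simp_all add: T(1-3), simp_all add: T(4)[of g] X Y)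
  then have "\<phi> (rf_bracket f1 g h) = rf_bracket f2 (\<phi> g) (\<phi> h)" for g h by (simp add: T_def)
  then show ?thesis
    unfolding poisson_iso_def using \<open>inj \<phi>\<close> surj c hom_add[OF \<phi>] hom_mult[OF \<phi>] by (simp add: bij_def)
qed

text \<open>The substitution extends to fractions because W has valuation 1 or -1 in k(x)((y)), so
  no nonzero polynomial in W over k[x] vanishes.\<close>

lemma rf_affine_hom:
  fixes a b :: "'a::field_char_0"
  assumes a: "a \<noteq> 0" and W: "W = rf_Y \<or> W = inverse (rf_Y :: 'a ratfun2)"
  obtains \<phi> where "is_hom \<phi>" "surj \<phi>" "\<And>c. \<phi> (rf_const c) = rf_const c" "\<phi> rf_Y = W"
    "\<And>p. \<phi> (rf_of_poly_x p) = rf_of_poly_x (pcompose p [:- b, a:])"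
proof -
  define g where "g p = rf_of_poly_x (pcompose p [:- b, a:])" for p
  have g: "is_hom g"
    by (rule is_homI) (simp_all add: g_def rf_of_poly_x_conv pcompose_1 pcompose_add pcompose_mult
        to_fract_add[symmetric] to_fract_mult[symmetric] one_pCons[symmetric] del: to_fract_add to_fract_mult)
  have nz: "hom_eval g W F \<noteq> 0" if F: "F \<noteq> 0" for F
  proof
    assume 0: "hom_eval g W F = 0"
    obtain k where k: "vge k (rf_to_fls W)" "rf_to_fls W $$ k = 1" "k \<noteq> 0"
    proof (cases "W = rf_Y")
      case True
      then show ?thesis using that[of 1] by (simp add: rf_to_fls_Y vge_def)
    next
      case False
      then have "rf_to_fls W = inverse fls_X" using W by (simp add: hom_inverse[OF hom_rf_to_fls] rf_to_fls_Y)
      moreover have "vge 1 (fls_X :: 'a poly fract fls)" "fls_X $$ 1 \<noteq> (0 :: 'a poly fract)"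
        by (simp_all add: vge_def)
      note vge_inverse[OF this] nth_inverse_vge[OF this]
      ultimately show ?thesis using that[of "-1"] by simp
    qed
    have h: "is_hom (\<lambda>p. rat_of_poly (pcompose p [:- b, a:]))"
      using hom_comp[OF hom_rf_to_fls g] by (simp add: g_def rf_to_fls_of_poly_x)
    have e: "rf_to_fls (hom_eval g W F) = hom_eval (\<lambda>p. rat_of_poly (pcompose p [:- b, a:])) (rf_to_fls W) F"
      by (simp add: hom_hom_eval_commute[OF hom_rf_to_fls g] g_def rf_to_fls_of_poly_x)
    obtain j where j: "coeff F j \<noteq> 0"
      "hom_eval (\<lambda>p. rat_of_poly (pcompose p [:- b, a:])) (rf_to_fls W) F $$ (k * int j) =
        rat_of_poly (pcompose (coeff F j) [:- b, a:]) $$ 0 * (rf_to_fls W $$ k) ^ j"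
      by (rule hom_eval_leading[OF h vge_fls_const _ k(1) F k(3)]) (use a in \<open>auto simp: pcompose_eq_0_iff\<close>)
    have "rf_to_fls (hom_eval g W F) $$ (k * int j) \<noteq> 0"
      unfolding e j(2) k(2) using j(1) a by (simp add: pcompose_eq_0_iff)
    then show False unfolding 0 hom_0[OF hom_rf_to_fls] by simp
  qed
  define \<phi> where "\<phi> = fract_lift (hom_eval g W)"
  have \<phi>: "is_hom \<phi>" unfolding \<phi>_def by (rule hom_fract_lift) (simp_all add: hom_hom_eval g nz)
  have \<phi>_to_fract: "\<phi> (to_fract F) = hom_eval g W F" for F
    unfolding \<phi>_def by (rule fract_lift_to_fract) (simp_all add: hom_hom_eval g nz)
  have x: "\<phi> (rf_of_poly_x p) = rf_of_poly_x (pcompose p [:- b, a:])" for p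
    by (simp add: rf_of_poly_x_conv[of p] \<phi>_to_fract hom_eval_pCons[OF g]) (simp add: g_def)
  have c: "\<phi> (rf_const c) = rf_const c" for c
    using x[of "[:c:]"] by (simp add: rf_of_poly_x_conv rf_const_conv)
  have Y: "\<phi> rf_Y = W"
    by (simp add: rf_Y_conv[of] \<phi>_to_fract hom_eval_pCons[OF g] hom_0[OF g] hom_1[OF g])
  have "q \<in> range \<phi>" for q
  proof (rule rf_generated)
    show "rf_const c \<in> range \<phi>" for c using c[of c] by (metis rangeI)
    \<comment> \<open>The preimage (x + b)/a of x inverts x \<mapsto> a x - b.\<close>
    have "\<phi> (rf_of_poly_x [:b / a, 1 / a:]) = rf_X"
      unfolding x using a by (simp add: rf_X_def pcompose_pCons)
    then show "rf_X \<in> range \<phi>" by (metis rangeI)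
    have "rf_Y = \<phi> rf_Y \<or> rf_Y = \<phi> (inverse rf_Y)" using W Y by (auto simp: hom_inverse[OF \<phi>])
    then show "rf_Y \<in> range \<phi>" by (metis rangeI)
    show "u + v \<in> range \<phi>" "u * v \<in> range \<phi>" if "u \<in> range \<phi>" "v \<in> range \<phi>" for u v
      using that by (auto simp flip: hom_add[OF \<phi>] hom_mult[OF \<phi>])
    show "inverse u \<in> range \<phi>" if "u \<in> range \<phi>" for u
      using that by (auto simp flip: hom_inverse[OF \<phi>])
  qed
  then have "surj \<phi>" by blast
  then show ?thesis using that[OF \<phi> _ c Y x] by blast
qed

text \<open>The isomorphism sends x to a x - b. For the plus sign it fixes y; for the minus sign it
  sends y to 1/y, since {x, 1/y} = - {x, y}/y^2.\<close>

lemma poisson_isomorphic_affine: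
  fixes a b :: "'a::field_char_0"
  assumes a: "a \<noteq> 0"
    and eq: "smult (inverse a) ([:- b, a:] * pcompose p1 [:- b, a:]) = [:0, 1:] * p2 \<or>
      smult (inverse a) ([:- b, a:] * pcompose p1 [:- b, a:]) = - ([:0, 1:] * p2)"
  shows "poisson_isomorphic (rf_of_poly_x p1 * rf_X * rf_Y) (rf_of_poly_x p2 * rf_X * rf_Y)"
proof -
  define L where "L = [:- b, a:]"
  define f2 where "f2 = rf_of_poly_x p2 * rf_X * rf_Y"
  have L: "rf_of_poly_x L = rf_const (- b) + rf_const a * rf_X"
    by (simp add: L_def rf_of_poly_x_conv rf_const_conv rf_X_conv flip: to_fract_add to_fract_mult to_fract_uminus)
  have bL: "rf_bracket f2 (rf_of_poly_x L) g = rf_const a * rf_bracket f2 rf_X g" for g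
    unfolding rf_bracket_swap[of f2 "rf_of_poly_x L" g] rf_bracket_swap[of f2 rf_X g]
    unfolding L
    by (simp add: deriv_add[OF is_deriv_rf_bracket] deriv_mult[OF is_deriv_rf_bracket] rf_bracket_const)
  have rfm: "rf_of_poly_x (p * q) = rf_of_poly_x p * rf_of_poly_x q" for p q :: "'a poly"
    by (simp add: rf_of_poly_x_conv flip: to_fract_mult)
  have Y0: "rf_Y \<noteq> (0 :: 'a ratfun2)" by (simp add: rf_Y_conv)
  consider (pos) "L * pcompose p1 L = smult a ([:0, 1:] * p2)" | (neg) "L * pcompose p1 L = - smult a ([:0, 1:] * p2)"
  proof -
    have "smult a (smult (inverse a) (L * pcompose p1 L)) = L * pcompose p1 L" using a by simp
    then show ?thesis using eq that unfolding L_def by (metis smult_minus_right)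
  qed
  then show ?thesis
  proof cases
    case pos
    obtain \<phi> where \<phi>: "is_hom \<phi>" "surj \<phi>" "\<And>c. \<phi> (rf_const c) = rf_const c" "\<phi> rf_Y = rf_Y"
      "\<And>p. \<phi> (rf_of_poly_x p) = rf_of_poly_x (pcompose p [:- b, a:])"
      by (rule rf_affine_hom[OF a, of rf_Y b]) auto
    have X: "\<phi> rf_X = rf_of_poly_x L" unfolding rf_X_def \<phi>(5) by (simp add: L_def pcompose_pCons)
    have "rf_of_poly_x (L * pcompose p1 L) = rf_const a * rf_X * rf_of_poly_x p2"
      unfolding pos by (simp add: rf_of_poly_x_conv rf_const_conv rf_X_conv flip: to_fract_mult)
    then have "\<phi> (rf_of_poly_x p1 * rf_X * rf_Y) = rf_const a * f2"
      unfolding hom_mult[OF \<phi>(1)] \<phi>(4,5) X L_def[symmetric] rfm f2_def by (simp add: mult_ac)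
    then have "rf_bracket f2 (\<phi> rf_X) (\<phi> rf_Y) = \<phi> (rf_of_poly_x p1 * rf_X * rf_Y)"
      unfolding X \<phi>(4) bL rf_bracket_X_Y by simp
    then show ?thesis
      unfolding poisson_isomorphic_def f2_def[symmetric] using poisson_isoI[OF \<phi>(1,3,2)] by blast
  next
    case neg
    obtain \<phi> where \<phi>: "is_hom \<phi>" "surj \<phi>" "\<And>c. \<phi> (rf_const c) = rf_const c" "\<phi> rf_Y = inverse rf_Y"
      "\<And>p. \<phi> (rf_of_poly_x p) = rf_of_poly_x (pcompose p [:- b, a:])"
      by (rule rf_affine_hom[OF a, of "inverse rf_Y" b]) auto
    have X: "\<phi> rf_X = rf_of_poly_x L" unfolding rf_X_def \<phi>(5) by (simp add: L_def pcompose_pCons)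
    have "rf_of_poly_x (L * pcompose p1 L) = - (rf_const a * rf_X * rf_of_poly_x p2)"
      unfolding neg by (simp add: rf_of_poly_x_conv rf_const_conv rf_X_conv flip: to_fract_mult to_fract_uminus)
    then have f1: "\<phi> (rf_of_poly_x p1 * rf_X * rf_Y) = - (rf_const a * rf_X * rf_of_poly_x p2) * inverse rf_Y"
      unfolding hom_mult[OF \<phi>(1)] \<phi>(4,5) X L_def[symmetric] rfm by (simp add: mult_ac)
    \<comment> \<open>The bracket with 1/y comes from applying the derivation {x, -} to y (1/y) =
      1.\<close>
    have "0 = f2 * inverse rf_Y + rf_Y * rf_bracket f2 rf_X (inverse rf_Y)"
      using deriv_mult[OF is_deriv_rf_bracket, of f2 rf_X rf_Y "inverse rf_Y"] Y0
      by (simp add: rf_bracket_X_Y deriv_1[OF is_deriv_rf_bracket])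
    then have "rf_Y * rf_bracket f2 rf_X (inverse rf_Y) = rf_Y * (- (rf_X * rf_of_poly_x p2) * inverse rf_Y)"
      using Y0 by (simp add: f2_def eq_neg_iff_add_eq_0 mult_ac add_ac)
    then have "rf_bracket f2 rf_X (inverse rf_Y) = - (rf_X * rf_of_poly_x p2) * inverse rf_Y"
      using Y0 by (metis mult_left_cancel)
    then have "rf_bracket f2 (\<phi> rf_X) (\<phi> rf_Y) = \<phi> (rf_of_poly_x p1 * rf_X * rf_Y)"
      unfolding X \<phi>(4) bL f1 by (simp add: mult.assoc)
    then show ?thesis
      unfolding poisson_isomorphic_def f2_def[symmetric] using poisson_isoI[OF \<phi>(1,3,2)] by blast
  qed
qed

section \<open>Inverse isomorphisms and the equivalence\<close>

lemma poisson_iso_inv: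
  assumes "poisson_iso f1 f2 \<phi>"
  shows "poisson_iso f2 f1 (inv \<phi>)"
proof -
  have b: "bij \<phi>" using assms by (simp add: poisson_iso_def)
  have i: "inv \<phi> (\<phi> u) = u" "\<phi> (inv \<phi> u) = u" for u
    using b by (simp_all add: bij_is_inj surj_f_inv_f[OF bij_is_surj[OF b]])
  have e: "inv \<phi> u = v" if "u = \<phi> v" for u v using that i by simp
  show ?thesis
    using assms b bij_imp_bij_inv[OF b] unfolding poisson_iso_def
    by (auto intro!: e simp: i)
qed

theorem corollary5p5:
  fixes p1 p2 :: "'a::field_char_0 poly"
  assumes "degree p1 > 0" and "degree p2 > 0"
  shows "(poisson_isomorphic (rf_of_poly_x p1 * rf_X * rf_Y) (rf_of_poly_x p2 * rf_X * rf_Y)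
            \<longleftrightarrow> (\<exists>a b. a \<noteq> 0 \<and>
                   (smult (inverse a) ([:- b, a:] * pcompose p1 [:- b, a:]) = [:0, 1:] * p2 \<or>
                    smult (inverse a) ([:- b, a:] * pcompose p1 [:- b, a:]) = - ([:0, 1:] * p2))))
         \<and> (poisson_isomorphic (rf_of_poly_x p1 * rf_X * rf_Y) (rf_of_poly_x p2 * rf_X * rf_Y)
            \<longrightarrow> degree p1 = degree p2)"
    (is "(?I \<longleftrightarrow> ?S) \<and> (?I \<longrightarrow> _)")
proof -
  have main: "?S \<and> degree p1 = degree p2" if ?I
  proof -
    obtain \<phi> where iso: "poisson_iso (rf_of_poly_x p1 * rf_X * rf_Y) (rf_of_poly_x p2 * rf_X * rf_Y) \<phi>"
      using \<open>?I\<close> by (auto simp: poisson_isomorphic_def)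
    \<comment> \<open>The isomorphism and its inverse give embeddings with p1 and p2 exchanged: the
      ambient bracket belongs to p2 in \<open>A\<close> and to p1 in \<open>B\<close>.\<close>
    interpret A: poisson_embedding "[:0, 1:] * p2" "[:0, 1:] * p1" "rf_to_fls (\<phi> rf_X)" "rf_to_fls (\<phi> rf_Y)"
      by (rule poisson_embedding_of_iso[OF iso])
    interpret B: poisson_embedding "[:0, 1:] * p1" "[:0, 1:] * p2"
      "rf_to_fls (inv \<phi> rf_X)" "rf_to_fls (inv \<phi> rf_Y)"
      by (rule poisson_embedding_of_iso[OF poisson_iso_inv[OF iso]])
    have deg: "degree ([:0, 1:] * p) = Suc (degree p)" if "degree p > 0" for p :: "'a poly"
      using that by (subst degree_mult_eq) auto
    note deg1 = deg[OF assms(1)] and deg2 = deg[OF assms(2)]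
    show ?thesis
    proof (cases "degree p2 \<ge> 2")
      case True
      then obtain a b t where d: "degree p2 = degree p1" and a: "a \<noteq> 0" and t: "t = 1 \<or> t = (-1 :: 'a)"
        and eq: "pcompose ([:0, 1:] * p1) [:- b, a:] = smult (t * a) ([:0, 1:] * p2)"
        using A.degree_ge_3_affine assms unfolding deg1 deg2 by auto
      have sm: "smult (inverse a) ([:- b, a:] * pcompose p1 [:- b, a:]) = smult t ([:0, 1:] * p2)"
      proof -
        have "[:- b, a:] * pcompose p1 [:- b, a:] = smult (t * a) ([:0, 1:] * p2)"
          unfolding eq[symmetric] pcompose_mult by (simp add: pcompose_pCons)
        then have "smult (inverse a) ([:- b, a:] * pcompose p1 [:- b, a:]) =
            smult (inverse a * (t * a)) ([:0, 1:] * p2)" by (simp only: smult_smult)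
        also have "inverse a * (t * a) = t" using a by simp
        finally show ?thesis .
      qed
      have ?S
        by (rule exI[of _ a], rule exI[of _ b], unfold sm) (use a t in auto)
      then show ?thesis using d by simp
    next
      case False
      \<comment> \<open>Otherwise \<open>B\<close> would force degree p2 = degree p1 \<ge> 2, which
        this branch excludes.\<close>
      have "\<not> degree p1 \<ge> 2" using B.degree_ge_3_affine False assms unfolding deg1 deg2 by auto
      with False assms have d: "degree p1 = 1" "degree p2 = 1" by auto
      obtain e1 c1 where p1: "p1 = [:e1, c1:]" "c1 \<noteq> 0" using degree1_coeffs[OF d(1)] by metis
      obtain e2 c2 where p2: "p2 = [:e2, c2:]" "c2 \<noteq> 0" using degree1_coeffs[OF d(2)] by metis
      have A: "\<exists>n::int. e1 = of_int n * e2" if "e1 \<noteq> 0"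
        by (rule A.quadratic_integer_multiple[of e2 c2 e1 c1]) (use p1 p2 that in auto)
      have B: "\<exists>n::int. e2 = of_int n * e1" if "e2 \<noteq> 0"
        by (rule B.quadratic_integer_multiple[of e1 c1 e2 c2]) (use p1 p2 that in auto)
      have "e1 = e2 \<or> e1 = - e2"
      proof (cases "e1 = 0 \<or> e2 = 0")
        case True
        then show ?thesis using A B by auto
      next
        case False
        obtain m n :: int where mn: "e1 = of_int m * e2" "e2 = of_int n * e1" using A B False by blast
        then have "of_int (n * m) * e2 = e2" by (simp add: mult.assoc)
        then have "of_int (n * m) = (1 :: 'a)" using False by simp
        \<comment> \<open>Integer multiples in both directions have unit factors, so e1 and e2
          differ by a sign.\<close>
        then have "n * m = 1" by (simp only: of_int_eq_1_iff)
        then have "m = 1 \<or> m = -1" by (metis mult.commute zmult_eq_1_iff)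
        then show ?thesis using mn(1) by auto
      qed
      then have ?S
      proof
        assume "e1 = e2"
        \<comment> \<open>Scaling x by a turns x(e1 + c1 x), after division by a, into x(e1 + a c1
          x); a is chosen to match c2 up to the required sign.\<close>
        then show ?S using p1 p2 by (intro exI[of _ "c2 / c1"] exI[of _ 0]) (simp add: pcompose_pCons)
      next
        assume "e1 = - e2"
        then show ?S using p1 p2 by (intro exI[of _ "- c2 / c1"] exI[of _ 0]) (simp add: pcompose_pCons)
      qed
      then show ?thesis using d by simp
    qed
  qed
  moreover have "?S \<Longrightarrow> ?I" using poisson_isomorphic_affine by blast
  ultimately show ?thesis by blast
qed

end
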